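(* Let $E$ be a Borel space and $Q$ a semi-Markov kernel on $\mathbb{R}_+\times E$ given $E$ satisfying the regularity condition: there exist $\delta>0$ and $\epsilon>0$ such that $Q(\delta,E\mid x)\le 1-\epsilon$ for all $x\in E$. Let $c,g:E\to[0,\infty)$ be measurable and fix $T\in\mathbb{R}_+$. Define $D^*=\{(s,x)\in(0,T]\times E: V^*(s,x)=g(x)\}$ and, for $\omega=(x_0,t_1,x_1,\dots,t_n,x_n,\dots)\in\Omega$, $$\tau^*(\omega)=\inf\Big\{n\in\mathbb{N}: \Big(T-\sum_{k=1}^n t_k,\ x_n\Big)\in D^*\Big\}\wedge\inf\Big\{n\in\mathbb{N}: T\le \sum_{k=1}^n t_k\Big\}$$ (with $\inf\emptyset=+\infty$). Then $\tau^*$ is a $T$-optimal stopping time, i.e. $V^{\tau^*}(T,x)=V^*(T,x)$ for all $x\in E$, and $\mathbb{P}_x(\tau^*=\infty)=0$ for all $x\in E$.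
   Context: Semi-Markov kernel: for each $B\in\mathcal{B}(E)$ and $x\in E$, $t\mapsto Q(t,B\mid x)$ is nondecreasing, right-continuous on $\mathbb{R}_+$ with $Q(0,B\mid x)=0$; for each $t$, $Q(t,\cdot\mid\cdot)$ is a substochastic kernel on $E$; $\lim_{t\to\infty}Q(t,\cdot\mid\cdot)$ is a stochastic kernel on $E$. Let $\Omega=\{(x_0,t_1,x_1,t_2,x_2,\dots): x_0\in E,\ (t_n,x_n)\in\mathbb{R}_+\times E\}$ with its product Borel $\sigma$-algebra; $X_n(\omega)=x_n$, $T_0=0$, $T_{n+1}(\omega)=t_{n+1}$, $S_n=\sum_{k=0}^n T_k$, $Y_n=(X_0,T_1,X_1,\dots,T_n,X_n)$, $\mathcal{F}_n=\sigma(T_0,X_0,\dots,T_n,X_n)$. For $x\in E$, $\mathbb{P}_x$ is the unique probability measure on $\Omega$ with $\mathbb{P}_x(T_0=0,X_0=x)=1$ and $\mathbb{P}_x(T_{n+1}\le t,X_{n+1}\in B\mid Y_n)=Q(t,B\mid X_n)$; $\mathbb{E}_x$ is its expectation. The process $X(t)=X_n$ for $S_n\le t<S_{n+1}$. A stopping time is a map $\tau:\Omega\to\mathbb{N}\cup\{+\infty\}$ ($\mathbb{N}=\{0,1,2,\dots\}$) with $\{\tau=n\}\in\mathcal{F}_n$ for all $n$; $\Gamma$ is the set of stopping times. For a horizon $s\in\mathbb{R}_+$ and $\tau\in\Gamma$, $R^s_\tau=\int_0^{S_\tau}c(X(t))\,dt+g(X(S_\tau))$ if $S_\tau<s$ and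 $R^s_\tau=\int_0^s c(X(t))\,dt$ if $S_\tau\ge s$ (with $S_\tau=\lim_n S_n$ on $\{\tau=\infty\}$); $V^\tau(s,x)=\mathbb{E}_x[R^s_\tau]$ and $V^*(s,x)=\inf_{\tau\in\Gamma}V^\tau(s,x)$. A stopping time $\tau^*$ is $T$-optimal if $V^{\tau^*}(T,x)=V^*(T,x)$ for all $x\in E$. *)

theory Defs
  imports "HOL-Probability.Probability"
begin

text \<open>A Borel space is realised as a Borel subset E of a Polish space, with the trace
  Borel sigma-algebra.\<close>

definition ME :: "'a::topological_space set \<Rightarrow> 'a measure" where
  "ME E = restrict_space borel E"

definition MTE :: "'a::topological_space set \<Rightarrow> (real \<times> 'a) measure" where
  "MTE E = restrict_space borel ({0::real..} \<times> E)"

text \<open>A path omega = (x0, seq) where seq n = (t_(n+1), x_(n+1)).\<close>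
type_synonym 'a path = "'a \<times> (nat \<Rightarrow> real \<times> 'a)"

definition Omega :: "'a::topological_space set \<Rightarrow> 'a path measure" where
  "Omega E = ME E \<Otimes>\<^sub>M (\<Pi>\<^sub>M n\<in>(UNIV::nat set). MTE E)"

definition Xn :: "'a path \<Rightarrow> nat \<Rightarrow> 'a" where
  "Xn \<omega> n = (case n of 0 \<Rightarrow> fst \<omega> | Suc k \<Rightarrow> snd (snd \<omega> k))"

definition Tn :: "'a path \<Rightarrow> nat \<Rightarrow> real" where
  "Tn \<omega> n = (case n of 0 \<Rightarrow> 0 | Suc k \<Rightarrow> fst (snd \<omega> k))"

definition Sn :: "'a path \<Rightarrow> nat \<Rightarrow> real" where
  "Sn \<omega> n = (\<Sum>k\<le>n. Tn \<omega> k)"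

definition Yn :: "nat \<Rightarrow> 'a path \<Rightarrow> 'a \<times> (nat \<Rightarrow> real \<times> 'a)" where
  "Yn n \<omega> = (fst \<omega>, restrict (snd \<omega>) {..<n})"

definition Filt :: "'a::topological_space set \<Rightarrow> nat \<Rightarrow> 'a path measure" where
  "Filt E n = vimage_algebra (space (Omega E)) (Yn n)
                (ME E \<Otimes>\<^sub>M (\<Pi>\<^sub>M k\<in>{..<n}. MTE E))"

definition Xt :: "'a path \<Rightarrow> real \<Rightarrow> 'a" where
  "Xt \<omega> t = Xn \<omega> (LEAST n. t < Sn \<omega> (Suc n))"

definition substochastic_kernel :: "'a::topological_space set \<Rightarrow> ('a set \<Rightarrow> 'a \<Rightarrow> real) \<Rightarrow> bool" where
  "substochastic_kernel E K \<longleftrightarrow>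
     (\<forall>B\<in>sets (ME E). (\<lambda>x. K B x) \<in> borel_measurable (ME E)) \<and>
     (\<forall>x\<in>E. (\<forall>B\<in>sets (ME E). 0 \<le> K B x) \<and>
             measure_space E (sets (ME E)) (\<lambda>B. ennreal (K B x)) \<and> K E x \<le> 1)"

definition stochastic_kernel :: "'a::topological_space set \<Rightarrow> ('a set \<Rightarrow> 'a \<Rightarrow> real) \<Rightarrow> bool" where
  "stochastic_kernel E K \<longleftrightarrow> substochastic_kernel E K \<and> (\<forall>x\<in>E. K E x = 1)"

definition semi_Markov_kernel ::
  "'a::topological_space set \<Rightarrow> (real \<Rightarrow> 'a set \<Rightarrow> 'a \<Rightarrow> real) \<Rightarrow> bool" where
  "semi_Markov_kernel E Q \<longleftrightarrow>
     (\<forall>B\<in>sets (ME E). \<forall>x\<in>E.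
        mono_on {0..} (\<lambda>t. Q t B x) \<and>
        (\<forall>t\<ge>0. continuous (at_right t) (\<lambda>t. Q t B x)) \<and>
        Q 0 B x = 0) \<and>
     (\<forall>t\<ge>0. substochastic_kernel E (Q t)) \<and>
     (\<exists>Qinf. (\<forall>B\<in>sets (ME E). \<forall>x\<in>E. ((\<lambda>t. Q t B x) \<longlongrightarrow> Qinf B x) at_top) \<and>
            stochastic_kernel E Qinf)"

text \<open>P is the law P_x of the embedded chain started at x: a probability measure on
  Omega with X_0 = x a.s. and
  P(T_(n+1) \<le> t, X_(n+1) \<in> B | Y_n) = Q(t,B | X_n), the conditional probability
  being expressed by its defining property on the sets of F_n = sigma(Y_n).\<close>
definition semi_Markov_law ::
  "'a::topological_space set \<Rightarrow> (real \<Rightarrow> 'a set \<Rightarrow> 'a \<Rightarrow> real) \<Rightarrow> 'a \<Rightarrow> 'a path measure \<Rightarrow> bool" where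
  "semi_Markov_law E Q x P \<longleftrightarrow>
     prob_space P \<and> sets P = sets (Omega E) \<and>
     measure P {\<omega>\<in>space P. fst \<omega> = x} = 1 \<and>
     (\<forall>n t B. t \<ge> 0 \<longrightarrow> B \<in> sets (ME E) \<longrightarrow>
        (\<forall>A\<in>sets (Filt E n).
           measure P (A \<inter> {\<omega>\<in>space P. Tn \<omega> (Suc n) \<le> t \<and> Xn \<omega> (Suc n) \<in> B})
           = (\<integral>\<omega>\<in>A. Q t B (Xn \<omega> n) \<partial>P)))"

definition is_stopping_time :: "'a::topological_space set \<Rightarrow> ('a path \<Rightarrow> enat) \<Rightarrow> bool" where
  "is_stopping_time E \<tau> \<longleftrightarrow> (\<forall>n. {\<omega>\<in>space (Omega E). \<tau> \<omega> = enat n} \<in> sets (Filt E n))"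

definition Stau :: "('a path \<Rightarrow> enat) \<Rightarrow> 'a path \<Rightarrow> ereal" where
  "Stau \<tau> \<omega> = (case \<tau> \<omega> of enat n \<Rightarrow> ereal (Sn \<omega> n) | \<infinity> \<Rightarrow> (SUP n. ereal (Sn \<omega> n)))"

definition Reward ::
  "('a \<Rightarrow> real) \<Rightarrow> ('a \<Rightarrow> real) \<Rightarrow> real \<Rightarrow> ('a path \<Rightarrow> enat) \<Rightarrow> 'a path \<Rightarrow> ennreal" where
  "Reward c g s \<tau> \<omega> =
     (if Stau \<tau> \<omega> < ereal s
      then (\<integral>\<^sup>+ t\<in>{0..<real_of_ereal (Stau \<tau> \<omega>)}. ennreal (c (Xt \<omega> t)) \<partial>lborel)
             + ennreal (g (Xt \<omega> (real_of_ereal (Stau \<tau> \<omega>))))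
      else (\<integral>\<^sup>+ t\<in>{0..<s}. ennreal (c (Xt \<omega> t)) \<partial>lborel))"

definition Vtau ::
  "('a \<Rightarrow> 'a path measure) \<Rightarrow> ('a \<Rightarrow> real) \<Rightarrow> ('a \<Rightarrow> real) \<Rightarrow> ('a path \<Rightarrow> enat)
     \<Rightarrow> real \<Rightarrow> 'a \<Rightarrow> ennreal" where
  "Vtau P c g \<tau> s x = (\<integral>\<^sup>+ \<omega>. Reward c g s \<tau> \<omega> \<partial>(P x))"

definition Vstar ::
  "'a::topological_space set \<Rightarrow> ('a \<Rightarrow> 'a path measure) \<Rightarrow> ('a \<Rightarrow> real) \<Rightarrow> ('a \<Rightarrow> real)
     \<Rightarrow> real \<Rightarrow> 'a \<Rightarrow> ennreal" where
  "Vstar E P c g s x = (INF \<tau>\<in>{\<tau>. is_stopping_time E \<tau>}. Vtau P c g \<tau> s x)"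

definition Dstar ::
  "'a::topological_space set \<Rightarrow> ('a \<Rightarrow> 'a path measure) \<Rightarrow> ('a \<Rightarrow> real) \<Rightarrow> ('a \<Rightarrow> real)
     \<Rightarrow> real \<Rightarrow> (real \<times> 'a) set" where
  "Dstar E P c g T = {(s, x). s \<in> {0<..T} \<and> x \<in> E \<and> Vstar E P c g s x = ennreal (g x)}"

definition enat_Least :: "(nat \<Rightarrow> bool) \<Rightarrow> enat" where
  "enat_Least p = (if \<exists>n. p n then enat (LEAST n. p n) else \<infinity>)"

definition tau_star ::
  "'a::topological_space set \<Rightarrow> ('a \<Rightarrow> 'a path measure) \<Rightarrow> ('a \<Rightarrow> real) \<Rightarrow> ('a \<Rightarrow> real)
     \<Rightarrow> real \<Rightarrow> 'a path \<Rightarrow> enat" where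
  "tau_star E P c g T \<omega> =
     min (enat_Least (\<lambda>n. (T - Sn \<omega> n, Xn \<omega> n) \<in> Dstar E P c g T))
         (enat_Least (\<lambda>n. T \<le> Sn \<omega> n))"

end

theory Submission
  imports Defs
begin

text \<open>
  Value iteration from below. Put V_0 = 0 and let V_{n+1}(r,x), for r > 0, be the minimum of
  g(x) and the expected cost of one transition followed by V_n at the remaining horizon; V_n
  vanishes for r \<open>\<le>\<close> 0. All costs being nonnegative, V_n increases to a measurable solution V of
  the optimality equation. Along the filtration of the embedded chain, the cost accumulated up to step k
  plus V_{N-k} at the current state is, for every stopping time, a submartingale ending below the
  reward, so V_N is a lower bound for each value. For the first time at which V equals g or the
  horizon is exhausted, the same process built from V is a supermartingale, so this time
  attains V. Hence V is the value function, and this time is tau*. Regularity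
  of Q rules out explosion, which makes tau* finite and the reward equal to the sum of
  the one-step costs.
\<close>

section \<open>Measurability on path space\<close>

text \<open>\<open>Vstar\<close> is an infimum over all stopping times, so neither its joint
  measurability nor an optimality equation for it is at hand. The argument therefore runs on the
  iterates, which are measurable by construction, and their supremum is identified with
  \<open>Vstar\<close> only after both bounds are proved. The two bounds use different processes for
  a reason. In the lower bound, a remainder built from V after n steps would have to tend to 0 in
  expectation, and with unbounded \<open>g\<close> no dominating function is available; letting the
  index fall with each step makes the remainder after N steps equal to V_0 = 0. In the upper bound
  the remainder is nonnegative on the favourable side and is simply dropped. Costs and values live
  in \<open>ennreal\<close>, so sums, integrals and suprema are exchanged by monotone convergence
  and no integrability of the costs is required.\<close>

lemma space_ME: "E \<in> sets borel \<Longrightarrow> space (ME E) = E"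
  by (simp add: ME_def)

text \<open>Second countability gives \<open>borel_prod\<close>; it remains to see that restriction
  to a rectangle commutes with the product. One inclusion is measurability of the identity, the
  other holds on generating rectangles.\<close>

lemma sets_MTE_pair:
  fixes E :: "'a::polish_space set"
  assumes "E \<in> sets borel"
  shows "sets (MTE E) = sets (restrict_space borel {0::real..} \<Otimes>\<^sub>M ME E)"
proof
  have incl: "(\<lambda>z. z) \<in> restrict_space borel {0::real..} \<Otimes>\<^sub>M ME E \<rightarrow>\<^sub>M borel \<Otimes>\<^sub>M borel"
  proof (rule measurable_pair)
    show "fst \<circ> (\<lambda>z. z) \<in> restrict_space borel {0::real..} \<Otimes>\<^sub>M ME E \<rightarrow>\<^sub>M borel"
      unfolding comp_def by (rule measurable_compose[OF measurable_fst measurable_restrict_space1]) simp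
    show "snd \<circ> (\<lambda>z. z) \<in> restrict_space borel {0::real..} \<Otimes>\<^sub>M ME E \<rightarrow>\<^sub>M borel"
      unfolding comp_def ME_def
      by (rule measurable_compose[OF measurable_snd measurable_restrict_space1]) simp
  qed
  have sp: "space (restrict_space borel {0::real..} \<Otimes>\<^sub>M ME E) = {0..} \<times> E"
    using assms by (simp add: space_pair_measure ME_def)
  have rect: "{0::real..} \<times> E \<in> sets borel"
    using assms by (simp flip: borel_prod)
  show "sets (MTE E) \<subseteq> sets (restrict_space borel {0::real..} \<Otimes>\<^sub>M ME E)"
  proof
    fix C assume "C \<in> sets (MTE E)"
    then have C: "C \<subseteq> {0..} \<times> E" "C \<in> sets (borel \<Otimes>\<^sub>M borel)"
      using rect unfolding MTE_def borel_prod by (auto simp: sets_restrict_space_iff)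
    have "(\<lambda>z. z) -` C \<inter> space (restrict_space borel {0::real..} \<Otimes>\<^sub>M ME E)
        \<in> sets (restrict_space borel {0::real..} \<Otimes>\<^sub>M ME E)"
      by (rule measurable_sets[OF incl C(2)])
    moreover have "(\<lambda>z. z) -` C \<inter> space (restrict_space borel {0::real..} \<Otimes>\<^sub>M ME E) = C"
      using C(1) sp by auto
    ultimately show "C \<in> sets (restrict_space borel {0::real..} \<Otimes>\<^sub>M ME E)" by simp
  qed
  have "a \<times> b \<in> sets (MTE E)" if "a \<in> sets (restrict_space borel {0::real..})" "b \<in> sets (ME E)" for a b
  proof -
    from that assms have "a \<in> sets borel" "b \<in> sets borel" "a \<subseteq> {0..}" "b \<subseteq> E"
      by (auto simp: sets_restrict_space_iff ME_def)
    then show ?thesis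
      using rect by (auto simp: MTE_def sets_restrict_space_iff simp flip: borel_prod)
  qed
  moreover have "space (MTE E) = {0..} \<times> E"
    using rect by (simp add: MTE_def)
  ultimately have "sigma_sets (space (MTE E)) {a \<times> b |a b. a \<in> sets (restrict_space borel {0::real..}) \<and> b \<in> sets (ME E)}
      \<subseteq> sets (MTE E)"
    by (intro sets.sigma_sets_subset) auto
  then show "sets (restrict_space borel {0::real..} \<Otimes>\<^sub>M ME E) \<subseteq> sets (MTE E)"
    using sp \<open>space (MTE E) = {0..} \<times> E\<close> by (simp add: sets_pair_measure space_pair_measure)
qed

lemma space_MTE:
  fixes E :: "'a::polish_space set"
  assumes "E \<in> sets borel"
  shows "space (MTE E) = {0..} \<times> E"
  using sets_eq_imp_space_eq[OF sets_MTE_pair[OF assms]] assms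
  by (simp add: space_pair_measure ME_def)

lemma sets_nonneg_reals: "sets (restrict_space borel {0::real..}) = sigma_sets {0..} (range (\<lambda>t. {0..t}))"
proof -
  have "sets (restrict_space borel {0::real..}) = (\<inter>) {0..} ` sigma_sets UNIV (range (\<lambda>a. {..a}))"
    unfolding sets_restrict_space by (subst borel_eq_atMost) simp
  also have "\<dots> = sigma_sets {0..} ((\<inter>) {0..} ` range (\<lambda>a::real. {..a}))"
    proof (rule sigma_sets_Int)
    have "sigma_sets UNIV (range atMost) = sets (borel :: real measure)"
      by (subst borel_eq_atMost) simp
    then show "{0::real..} \<in> sigma_sets UNIV (range atMost)" by simp
  qed simp
  also have "(\<inter>) {0..} ` range (\<lambda>a::real. {..a}) = range (\<lambda>t. {0..t})"
    by (auto simp: image_image atLeastAtMost_def)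
  finally show ?thesis .
qed

text \<open>These are the sets on which \<open>Q\<close> prescribes probabilities, so every
  uniqueness and measurability argument about one step starts from them. A negative t gives the
  empty set, whence the case distinctions on \<open>0 \<le> t\<close> below.\<close>

definition rect_gen :: "'a::topological_space set \<Rightarrow> (real \<times> 'a) set set" where
  "rect_gen E = {{0..t} \<times> B |t B. B \<in> sets (ME E)}"

lemma sets_MTE_rect_gen:
  fixes E :: "'a::polish_space set"
  assumes E: "E \<in> sets borel"
  shows "sets (MTE E) = sigma_sets ({0..} \<times> E) (rect_gen E)"
proof -
  have "sets (restrict_space borel {0::real..} \<Otimes>\<^sub>M ME E) =
    sets (sigma (space (restrict_space borel {0::real..}) \<times> space (ME E))
      {a \<times> b |a b. a \<in> range (\<lambda>t. {0..t}) \<and> b \<in> sets (ME E)})"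
  proof (rule sets_pair_eq)
    show "countable (range (\<lambda>n::nat. {0..real n}))" by simp
    show "\<Union> (range (\<lambda>n::nat. {0..real n})) = space (restrict_space borel {0..})"
      by (auto simp: real_arch_simple)
    show "countable {space (ME E)}" by simp
  qed (auto simp: sets_nonneg_reals sets.sigma_sets_eq dest: sets.sets_into_space)
  also have "{a \<times> b |a b. a \<in> range (\<lambda>t::real. {0..t}) \<and> b \<in> sets (ME E)} = rect_gen E"
    unfolding rect_gen_def by blast
  finally show ?thesis
    using E sets.sets_into_space[of _ "ME E"]
    by (simp add: sets_MTE_pair space_ME, subst sets_measure_of; fastforce simp: rect_gen_def space_ME)
qed

lemma Int_stable_rect_gen: "Int_stable (rect_gen E)"
proof (rule Int_stableI)
  fix a b assume "a \<in> rect_gen E" "b \<in> rect_gen E"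
  then obtain t s A B where "a = {0..t} \<times> A" "b = {0..s} \<times> B" "A \<in> sets (ME E)" "B \<in> sets (ME E)"
    by (auto simp: rect_gen_def)
  moreover from this have "a \<inter> b = {0..min t s} \<times> (A \<inter> B)" by auto
  ultimately show "a \<inter> b \<in> rect_gen E"
    unfolding rect_gen_def by blast
qed

lemma measurable_space_subset: "f \<in> M \<rightarrow>\<^sub>M N \<Longrightarrow> f \<in> space M \<rightarrow> space N"
  by (auto simp: measurable_def)

lemma fst_MTE_measurable: "fst \<in> MTE E \<rightarrow>\<^sub>M restrict_space borel {0..}"
  and snd_MTE_measurable: "snd \<in> MTE E \<rightarrow>\<^sub>M ME E"
  if "E \<in> sets borel" for E :: "'a::polish_space set"
  using measurable_fst measurable_snd
  by (simp_all add: measurable_cong_sets[OF sets_MTE_pair[OF that] refl])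

lemma fst_MTE_borel: "E \<in> sets borel \<Longrightarrow> fst \<in> borel_measurable (MTE E)"
  for E :: "'a::polish_space set"
  by (rule measurable_restrict_space2_iff[THEN iffD1, THEN conjunct1, OF fst_MTE_measurable])

section \<open>The filtration of the embedded chain\<close>

lemma Yn_measurable: "Yn n \<in> Omega E \<rightarrow>\<^sub>M ME E \<Otimes>\<^sub>M (\<Pi>\<^sub>M k\<in>{..<n}. MTE E)"
  unfolding Yn_def Omega_def by (intro measurable_Pair measurable_fst''
    measurable_compose[OF measurable_snd measurable_restrict_subset]) auto

lemma space_Filt: "space (Filt E n) = space (Omega E)"
  by (simp add: Filt_def)

lemma Yn_Filt_measurable: "Yn n \<in> Filt E n \<rightarrow>\<^sub>M ME E \<Otimes>\<^sub>M (\<Pi>\<^sub>M k\<in>{..<n}. MTE E)"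
  unfolding Filt_def
  by (rule measurable_vimage_algebra1[OF measurable_space_subset[OF Yn_measurable]])

text \<open>Inclusion of sigma-algebras is phrased as measurability of the identity, so that
  composition transfers measurable functions as well as sets.\<close>

lemma Filt_in_Omega: "(\<lambda>\<omega>. \<omega>) \<in> Omega E \<rightarrow>\<^sub>M Filt E n"
  unfolding Filt_def by (rule measurable_vimage_algebra2) (simp_all add: Yn_measurable)

lemma step_Filt_measurable: "k < n \<Longrightarrow> (\<lambda>\<omega>. snd \<omega> k) \<in> Filt E n \<rightarrow>\<^sub>M MTE E"
proof -
  assume k: "k < n"
  have "(\<lambda>\<omega>. snd (Yn n \<omega>) k) \<in> Filt E n \<rightarrow>\<^sub>M MTE E"
    using k by (intro measurable_compose[OF Yn_Filt_measurable]
        measurable_compose[OF measurable_snd measurable_component_singleton]) simp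
  then show ?thesis using k by (simp add: Yn_def)
qed

lemma start_Filt_measurable: "fst \<in> Filt E n \<rightarrow>\<^sub>M ME E"
proof -
  have "(\<lambda>\<omega>. fst (Yn n \<omega>)) \<in> Filt E n \<rightarrow>\<^sub>M ME E"
    by (rule measurable_compose[OF Yn_Filt_measurable measurable_fst])
  then show ?thesis by (simp add: Yn_def)
qed

lemma Filt_mono: "m \<le> n \<Longrightarrow> (\<lambda>\<omega>. \<omega>) \<in> Filt E n \<rightarrow>\<^sub>M Filt E m"
  unfolding Filt_def[of E m]
proof (rule measurable_vimage_algebra2)
  assume "m \<le> n"
  then show "Yn m \<in> Filt E n \<rightarrow>\<^sub>M ME E \<Otimes>\<^sub>M (\<Pi>\<^sub>M k\<in>{..<m}. MTE E)"
    unfolding Yn_def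
    by (intro measurable_Pair start_Filt_measurable measurable_restrict step_Filt_measurable) auto
qed (simp add: space_Filt)

lemma sets_Filt_mono: "m \<le> n \<Longrightarrow> A \<in> sets (Filt E m) \<Longrightarrow> A \<in> sets (Filt E n)"
  using measurable_sets[OF Filt_mono, of m n A E] sets.sets_into_space[of A "Filt E m"]
  by (simp add: space_Filt Int_absorb2)

lemma sets_Filt_Omega: "A \<in> sets (Filt E m) \<Longrightarrow> A \<in> sets (Omega E)"
  using measurable_sets[OF Filt_in_Omega, of A E m] sets.sets_into_space[of A "Filt E m"]
  by (simp add: space_Filt Int_absorb2)

context
  fixes E :: "'a::polish_space set"
  assumes E: "E \<in> sets borel"
begin

lemma Xn_Filt_measurable: "k \<le> n \<Longrightarrow> (\<lambda>\<omega>. Xn \<omega> k) \<in> Filt E n \<rightarrow>\<^sub>M ME E"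
  unfolding Xn_def
  by (cases k) (auto intro: start_Filt_measurable measurable_compose[OF step_Filt_measurable snd_MTE_measurable[OF E]])

lemma Tn_Filt_measurable: "k \<le> n \<Longrightarrow> (\<lambda>\<omega>. Tn \<omega> k) \<in> borel_measurable (Filt E n)"
  unfolding Tn_def
  by (cases k) (auto intro: measurable_compose[OF step_Filt_measurable fst_MTE_borel[OF E]])

lemma Sn_Filt_measurable: "k \<le> n \<Longrightarrow> (\<lambda>\<omega>. Sn \<omega> k) \<in> borel_measurable (Filt E n)"
  unfolding Sn_def by (intro borel_measurable_sum Tn_Filt_measurable) auto

lemma Xn_measurable: "(\<lambda>\<omega>. Xn \<omega> k) \<in> Omega E \<rightarrow>\<^sub>M ME E"
  by (rule measurable_compose[OF Filt_in_Omega Xn_Filt_measurable[OF order_refl]])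

lemma Tn_measurable: "(\<lambda>\<omega>. Tn \<omega> k) \<in> borel_measurable (Omega E)"
  by (rule measurable_compose[OF Filt_in_Omega Tn_Filt_measurable[OF order_refl]])

lemma Sn_measurable: "(\<lambda>\<omega>. Sn \<omega> k) \<in> borel_measurable (Omega E)"
  by (rule measurable_compose[OF Filt_in_Omega Sn_Filt_measurable[OF order_refl]])

lemma step_measurable: "(\<lambda>\<omega>. snd \<omega> k) \<in> Omega E \<rightarrow>\<^sub>M MTE E"
  by (rule measurable_compose[OF Filt_in_Omega step_Filt_measurable[OF lessI]])

lemma Xn_in_E: "\<omega> \<in> space (Omega E) \<Longrightarrow> Xn \<omega> k \<in> E"
  using measurable_space[OF Xn_measurable] space_ME[OF E] by blast

lemma step_in_MTE: "\<omega> \<in> space (Omega E) \<Longrightarrow> snd \<omega> k \<in> {0..} \<times> E"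
  using measurable_space[OF step_measurable] space_MTE[OF E] by blast

lemma Tn_nonneg: "\<omega> \<in> space (Omega E) \<Longrightarrow> 0 \<le> Tn \<omega> k"
  using step_in_MTE[of \<omega> "k - 1"] by (cases k) (auto simp: Tn_def)

end

lemma Sn_0: "Sn \<omega> 0 = 0" and Sn_Suc: "Sn \<omega> (Suc n) = Sn \<omega> n + Tn \<omega> (Suc n)"
  by (simp_all add: Sn_def Tn_def)

lemma Tn_Suc: "Tn \<omega> (Suc n) = fst (snd \<omega> n)" and Xn_Suc: "Xn \<omega> (Suc n) = snd (snd \<omega> n)"
  by (simp_all add: Xn_def Tn_def)

section \<open>The transition kernel and the Markov property\<close>

locale semi_Markov =
  fixes E :: "'a::polish_space set" and Q :: "real \<Rightarrow> 'a set \<Rightarrow> 'a \<Rightarrow> real"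
    and P :: "'a \<Rightarrow> 'a path measure"
  assumes E_borel: "E \<in> sets borel" and E_ne: "E \<noteq> {}"
    and Q_kernel: "semi_Markov_kernel E Q"
    and regular: "\<exists>\<delta>>0. \<exists>\<epsilon>>0. \<forall>x\<in>E. Q \<delta> E x \<le> 1 - \<epsilon>"
    and P_law: "\<forall>x\<in>E. semi_Markov_law E Q x (P x)"
begin

lemmas [measurable] = Xn_measurable[OF E_borel] Tn_measurable[OF E_borel] Sn_measurable[OF E_borel]
  step_measurable[OF E_borel]

text \<open>Reading the one-step kernel off the laws P makes a Caratheodory extension of Q
  unnecessary; measurability in the starting point is inherited from Q on a generating
  intersection-stable family.\<close>
definition step_law :: "'a \<Rightarrow> (real \<times> 'a) measure" where
  "step_law x = distr (P x) (MTE E) (\<lambda>\<omega>. snd \<omega> 0)"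

lemma sets_P: "x \<in> E \<Longrightarrow> sets (P x) = sets (Omega E)"
  and space_P: "x \<in> E \<Longrightarrow> space (P x) = space (Omega E)"
  and prob_P: "x \<in> E \<Longrightarrow> prob_space (P x)"
proof -
  assume "x \<in> E"
  then have "semi_Markov_law E Q x (P x)" using P_law by blast
  then show "sets (P x) = sets (Omega E)" "prob_space (P x)"
    by (simp_all add: semi_Markov_law_def)
  then show "space (P x) = space (Omega E)"
    by (intro sets_eq_imp_space_eq)
qed

lemma AE_start: assumes "x \<in> E" shows "AE \<omega> in P x. Xn \<omega> 0 = x"
proof -
  interpret prob_space "P x" using assms by (rule prob_P)
  have "semi_Markov_law E Q x (P x)" using P_law assms by blast
  then have "prob {\<omega>\<in>space (P x). fst \<omega> = x} = 1"
    by (simp add: semi_Markov_law_def)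
  then have "AE \<omega> in P x. \<omega> \<in> {\<omega>\<in>space (P x). fst \<omega> = x}"
    \<comment> \<open>The event must be measurable: outside the sigma-algebra \<open>measure\<close>
      returns 0, not 1.\<close>
    using measure_notin_sets[of "{\<omega>\<in>space (P x). fst \<omega> = x}" "P x"] by (subst prob_eq_1[symmetric]) auto
  then show ?thesis by eventually_elim (simp add: Xn_def)
qed

lemma Q_measurable: "0 \<le> t \<Longrightarrow> B \<in> sets (ME E) \<Longrightarrow> Q t B \<in> borel_measurable (ME E)"
  using Q_kernel unfolding semi_Markov_kernel_def substochastic_kernel_def by blast

lemma Q_law:
  assumes "x \<in> E" "0 \<le> t" "B \<in> sets (ME E)" "A \<in> sets (Filt E n)"
  shows "measure (P x) (A \<inter> {\<omega>\<in>space (P x). snd \<omega> n \<in> {0..t} \<times> B}) = (\<integral>\<omega>. indicator A \<omega> * Q t B (Xn \<omega> n) \<partial>P x)"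
proof -
  have "{\<omega>\<in>space (P x). snd \<omega> n \<in> {0..t} \<times> B} = {\<omega>\<in>space (P x). Tn \<omega> (Suc n) \<le> t \<and> Xn \<omega> (Suc n) \<in> B}"
    using step_in_MTE[OF E_borel] by (fastforce simp: Tn_Suc Xn_Suc space_P[OF assms(1)] mem_Times_iff)
  moreover have "semi_Markov_law E Q x (P x)" using P_law assms by blast
  ultimately show ?thesis
    using assms(2-4) by (simp add: semi_Markov_law_def set_lebesgue_integral_def)
qed

lemma rect_gen_sets: "C \<in> rect_gen E \<Longrightarrow> C \<in> sets (MTE E)"
  by (simp add: sets_MTE_rect_gen[OF E_borel])

lemma rect_sets: "B \<in> sets (ME E) \<Longrightarrow> {0..t} \<times> B \<in> sets (MTE E)"
  by (rule rect_gen_sets) (unfold rect_gen_def, blast)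

lemma sets_step_law: "sets (step_law x) = sets (MTE E)" and space_step_law: "space (step_law x) = {0..} \<times> E"
  by (simp_all add: step_law_def space_MTE[OF E_borel])

lemma prob_step_law: "x \<in> E \<Longrightarrow> prob_space (step_law x)"
  unfolding step_law_def
  by (intro prob_space.prob_space_distr prob_P)
    (simp_all add: step_measurable[OF E_borel] measurable_cong_sets[OF sets_P refl])

text \<open>The defining property of the law at n = 0 with the whole space as conditioning event; as
  X_0 = x almost surely, the integrand is constant.\<close>

lemma step_law_rect:
  assumes x: "x \<in> E" and t: "0 \<le> t" and B: "B \<in> sets (ME E)"
  shows "measure (step_law x) ({0..t} \<times> B) = Q t B x"
proof -
  interpret prob_space "P x" using x by (rule prob_P)
  note [measurable_cong] = sets_P[OF x]
  have C: "{0..t} \<times> B \<in> sets (MTE E)"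
    using B by (rule rect_sets)
  note [measurable] = Q_measurable[OF t B]
  have "measure (step_law x) ({0..t} \<times> B) = prob (space (P x) \<inter> {\<omega>\<in>space (P x). snd \<omega> 0 \<in> {0..t} \<times> B})"
    using x C unfolding step_law_def by (subst measure_distr) (auto intro!: arg_cong[where f=prob])
  also have "\<dots> = (\<integral>\<omega>. indicator (space (P x)) \<omega> * Q t B (Xn \<omega> 0) \<partial>P x)"
    using sets.top[of "Filt E 0"] by (intro Q_law assms) (simp add: space_Filt space_P x)
  also have "\<dots> = (\<integral>\<omega>. Q t B x \<partial>P x)"
    using AE_start[OF x] x by (intro integral_cong_AE) auto
  finally show ?thesis by (simp add: prob_space)
qed

lemma emeasure_step_law_rect:
  assumes "x \<in> E" "0 \<le> t" "B \<in> sets (ME E)"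
  shows "emeasure (step_law x) ({0..t} \<times> B) = ennreal (Q t B x)"
proof -
  interpret prob_space "step_law x" by (rule prob_step_law) fact
  show ?thesis by (simp add: emeasure_eq_measure step_law_rect assms)
qed

lemma Q_bounds: assumes "x \<in> E" "0 \<le> t" "B \<in> sets (ME E)" shows "0 \<le> Q t B x" "Q t B x \<le> 1"
  using step_law_rect[OF assms] prob_space.prob_le_1[OF prob_step_law[OF assms(1)]] measure_nonneg by metis+

lemma step_law_measurable[measurable]: "step_law \<in> ME E \<rightarrow>\<^sub>M subprob_algebra (MTE E)"
proof (rule measurable_prob_algebraD, rule measurable_prob_algebra_generated[OF sets_MTE_rect_gen[OF E_borel] Int_stable_rect_gen])
  show "rect_gen E \<subseteq> Pow ({0..} \<times> E)"
    using sets.sets_into_space[OF rect_gen_sets] space_MTE[OF E_borel] by blast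
  fix C assume "C \<in> rect_gen E"
  then obtain t B where C: "C = {0..t} \<times> B" "B \<in> sets (ME E)"
    by (auto simp: rect_gen_def)
  show "(\<lambda>x. emeasure (step_law x) C) \<in> borel_measurable (ME E)"
  proof (cases "0 \<le> t")
    case True
    have "(\<lambda>x. ennreal (Q t B x)) \<in> borel_measurable (ME E)"
      using Q_measurable[OF True C(2)] by measurable
    then show ?thesis
      using True C by (subst measurable_cong[where g="\<lambda>x. ennreal (Q t B x)"])
        (auto simp: emeasure_step_law_rect space_ME[OF E_borel])
  qed (simp add: C)
qed (auto simp: space_ME[OF E_borel] prob_step_law sets_step_law)

text \<open>The law fixes the joint distribution of the history and the next step only on products
  of a set in \<open>Filt E n\<close> with a member of \<open>rect_gen E\<close>. These products are
  stable under intersection and generate the product sigma-algebra, so the joint distribution is the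
  one that draws the history first and the step from \<open>step_law\<close> at the current state
  afterwards. Integrating \<open>f\<close> against both descriptions gives the claim.\<close>

lemma Markov_property:
  assumes x: "x \<in> E" and f[measurable]: "f \<in> borel_measurable (Filt E n \<Otimes>\<^sub>M MTE E)"
  shows "(\<integral>\<^sup>+\<omega>. f (\<omega>, snd \<omega> n) \<partial>P x) = (\<integral>\<^sup>+\<omega>. (\<integral>\<^sup>+z. f (\<omega>, z) \<partial>step_law (Xn \<omega> n)) \<partial>P x)"
proof -
  interpret prob_space "P x" using x by (rule prob_P)
  note [measurable_cong] = sets_P[OF x]
  let ?N = "Filt E n \<Otimes>\<^sub>M MTE E"
  let ?G = "{A \<times> C |A C. A \<in> sets (Filt E n) \<and> C \<in> rect_gen E}"
  let ?\<Omega> = "space (Omega E) \<times> ({0..} \<times> E)"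
  let ?L = "distr (P x) ?N (\<lambda>\<omega>. (\<omega>, snd \<omega> n))"
  \<comment> \<open>The history is carried along as a fixed first coordinate, so that binding with
    this kernel yields a measure on pairs.\<close>
  let ?k = "\<lambda>\<omega>. distr (step_law (Xn \<omega> n)) ?N (Pair \<omega>)"
  let ?R = "P x \<bind> ?k"
  have id: "(\<lambda>\<omega>. \<omega>) \<in> P x \<rightarrow>\<^sub>M Filt E n"
    unfolding measurable_cong_sets[OF sets_P[OF x] refl] by (rule Filt_in_Omega)
  have Xn_P: "(\<lambda>\<omega>. Xn \<omega> n) \<in> P x \<rightarrow>\<^sub>M ME E" and step_P: "(\<lambda>\<omega>. snd \<omega> n) \<in> P x \<rightarrow>\<^sub>M MTE E"
    unfolding measurable_cong_sets[OF sets_P[OF x] refl]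
    by (rule Xn_measurable[OF E_borel], rule step_measurable[OF E_borel])
  have pairL: "(\<lambda>\<omega>. (\<omega>, snd \<omega> n)) \<in> P x \<rightarrow>\<^sub>M ?N"
    by (rule measurable_Pair[OF id step_P])
  have k: "?k \<in> P x \<rightarrow>\<^sub>M subprob_algebra ?N"
  proof (rule measurable_distr2[where M="MTE E"])
    show "(\<lambda>(\<omega>, z). (\<omega>, z)) \<in> P x \<Otimes>\<^sub>M MTE E \<rightarrow>\<^sub>M ?N"
      unfolding case_prod_beta
      by (intro measurable_Pair measurable_compose[OF measurable_fst id] measurable_snd)
    show "(\<lambda>\<omega>. step_law (Xn \<omega> n)) \<in> P x \<rightarrow>\<^sub>M subprob_algebra (MTE E)"
      by (rule measurable_compose[OF Xn_P step_law_measurable])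
  qed
  have sub: "rect_gen E \<subseteq> Pow ({0..} \<times> E)"
    using sets.sets_into_space[OF rect_gen_sets] space_MTE[OF E_borel] by blast
  have G_sub: "?G \<subseteq> Pow ?\<Omega>"
  proof
    fix Z assume "Z \<in> ?G"
    then obtain A C where "Z = A \<times> C" "A \<subseteq> space (Omega E)" "C \<subseteq> {0..} \<times> E"
      using sub sets.sets_into_space[of _ "Filt E n"] by (auto simp: space_Filt)
    then show "Z \<in> Pow ?\<Omega>" by auto
  qed
  have gen: "sets ?N = sigma_sets ?\<Omega> ?G"
  proof -
    have "sets ?N = sets (sigma (space (Filt E n) \<times> space (MTE E)) ?G)"
    proof (rule sets_pair_eq)
      show "countable {space (Filt E n)}" "countable (range (\<lambda>m::nat. {0..real m} \<times> E))" by simp_all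
      show "range (\<lambda>m::nat. {0..real m} \<times> E) \<subseteq> rect_gen E"
        using sets.top[of "ME E"] by (auto simp: rect_gen_def space_ME[OF E_borel])
      show "\<Union> (range (\<lambda>m::nat. {0..real m} \<times> E)) = space (MTE E)"
        by (auto simp: space_MTE[OF E_borel] real_arch_simple)
      show "sets (Filt E n) \<subseteq> Pow (space (Filt E n))" by (rule sets.space_closed)
      show "rect_gen E \<subseteq> Pow (space (MTE E))" using sub by (simp add: space_MTE[OF E_borel])
    qed (simp_all add: sets.sigma_sets_eq sets_MTE_rect_gen[OF E_borel] space_MTE[OF E_borel])
    also have "\<dots> = sigma_sets ?\<Omega> ?G"
      using G_sub by (simp add: space_Filt space_MTE[OF E_borel])
    finally show ?thesis .
  qed
  have "?L = ?R"
  proof (rule measure_eqI_generator_eq[where A="\<lambda>m. space (Omega E) \<times> ({0..real m} \<times> E)"])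
    show "Int_stable ?G"
    proof (rule Int_stableI)
      fix a b assume "a \<in> ?G" "b \<in> ?G"
      then obtain A C A' C' where "a = A \<times> C" "b = A' \<times> C'" "A \<in> sets (Filt E n)" "A' \<in> sets (Filt E n)"
        "C \<in> rect_gen E" "C' \<in> rect_gen E" by auto
      moreover from this have "a \<inter> b = (A \<inter> A') \<times> (C \<inter> C')" by auto
      moreover have "C \<inter> C' \<in> rect_gen E"
        using Int_stable_rect_gen \<open>C \<in> rect_gen E\<close> \<open>C' \<in> rect_gen E\<close> by (rule Int_stableD)
      ultimately show "a \<inter> b \<in> ?G" by blast
    qed
    show "?G \<subseteq> Pow ?\<Omega>"
by (rule G_sub)
    show "sets ?L = sigma_sets ?\<Omega> ?G" by (simp add: gen)
    show "sets ?R = sigma_sets ?\<Omega> ?G"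
      unfolding gen[symmetric] by (rule sets_bind) (auto simp: not_empty)
    show "range (\<lambda>m. space (Omega E) \<times> ({0..real m} \<times> E)) \<subseteq> ?G"
      using sets.top[of "ME E"] sets.top[of "Filt E n"]
      by (auto simp: rect_gen_def space_ME[OF E_borel] space_Filt)
    show "(\<Union>m. space (Omega E) \<times> ({0..real m} \<times> E)) = ?\<Omega>"
      by (auto simp: real_arch_simple)
    show "emeasure ?L (space (Omega E) \<times> ({0..real m} \<times> E)) \<noteq> \<infinity>" for m
      using finite_measure.emeasure_finite[OF finite_measure_distr[OF pairL]] by simp
    fix Z assume "Z \<in> ?G"
    then obtain A t B where Z: "Z = A \<times> ({0..t} \<times> B)" and A[measurable]: "A \<in> sets (Filt E n)" and B: "B \<in> sets (ME E)"
      by (auto simp: rect_gen_def)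
    have C[measurable]: "{0..t} \<times> B \<in> sets (MTE E)"
      using B by (rule rect_sets)
    have AO: "A \<in> sets (Omega E)" using A by (rule sets_Filt_Omega)
    have "emeasure ?R Z = (\<integral>\<^sup>+\<omega>. emeasure (?k \<omega>) Z \<partial>P x)"
      unfolding Z by (rule emeasure_bind[OF not_empty k]) simp
    also have "\<dots> = (\<integral>\<^sup>+\<omega>. indicator A \<omega> * emeasure (step_law (Xn \<omega> n)) ({0..t} \<times> B) \<partial>P x)"
    proof (rule nn_integral_cong)
      fix \<omega> assume "\<omega> \<in> space (P x)"
      then have w: "\<omega> \<in> space (Filt E n)" by (simp add: space_Filt space_P x)
      have "Pair \<omega> \<in> step_law (Xn \<omega> n) \<rightarrow>\<^sub>M ?N"
        using measurable_Pair1'[OF w] by (simp add: measurable_cong_sets[OF sets_step_law refl])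
      then have "emeasure (?k \<omega>) Z = emeasure (step_law (Xn \<omega> n)) (Pair \<omega> -` Z \<inter> space (step_law (Xn \<omega> n)))"
        unfolding Z by (rule emeasure_distr) simp
      also have "Pair \<omega> -` Z \<inter> space (step_law (Xn \<omega> n)) = (if \<omega> \<in> A then {0..t} \<times> B else {})"
        using sets.sets_into_space[OF C] by (auto simp: Z space_step_law space_MTE[OF E_borel])
      finally show "emeasure (?k \<omega>) Z = indicator A \<omega> * emeasure (step_law (Xn \<omega> n)) ({0..t} \<times> B)"
        by (simp add: indicator_def)
    qed
    also have "\<dots> = emeasure (P x) (A \<inter> {\<omega>\<in>space (P x). snd \<omega> n \<in> {0..t} \<times> B})"
    proof (cases "0 \<le> t")
      case True
      note [measurable] = Q_measurable[OF True B]
      have "(\<integral>\<^sup>+\<omega>. indicator A \<omega> * emeasure (step_law (Xn \<omega> n)) ({0..t} \<times> B) \<partial>P x)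
        = (\<integral>\<^sup>+\<omega>. ennreal (indicator A \<omega> * Q t B (Xn \<omega> n)) \<partial>P x)"
        by (intro nn_integral_cong)
          (auto simp: emeasure_step_law_rect True B Xn_in_E[OF E_borel] space_P x split: split_indicator)
      also have "\<dots> = ennreal (\<integral>\<omega>. indicator A \<omega> * Q t B (Xn \<omega> n) \<partial>P x)"
      proof (rule nn_integral_eq_integral)
        show "integrable (P x) (\<lambda>\<omega>. indicator A \<omega> * Q t B (Xn \<omega> n))"
          using AO sets_P[OF x]
          by (intro integrable_const_bound[where B=1] AE_I2)
             (auto simp: Q_bounds True B Xn_in_E[OF E_borel] space_P x split: split_indicator)
        show "AE \<omega> in P x. 0 \<le> indicator A \<omega> * Q t B (Xn \<omega> n)"
          by (rule AE_I2) (auto simp: Q_bounds True B Xn_in_E[OF E_borel] space_P x split: split_indicator)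
      qed
      finally show ?thesis
        by (simp add: emeasure_eq_measure Q_law[OF x True B A])
    qed simp
    also have "\<dots> = emeasure ?L Z"
      unfolding Z using sets.sets_into_space[OF A]
      by (subst emeasure_distr[OF pairL]) (auto intro!: arg_cong[where f="emeasure (P x)"] simp: space_Filt space_P x)
    finally show "emeasure ?L Z = emeasure ?R Z" ..
  qed
  have "(\<integral>\<^sup>+\<omega>. f (\<omega>, snd \<omega> n) \<partial>P x) = (\<integral>\<^sup>+z. f z \<partial>?L)"
    using f by (subst nn_integral_distr[OF pairL]) simp_all
  also have "\<dots> = (\<integral>\<^sup>+\<omega>. (\<integral>\<^sup>+z. f z \<partial>?k \<omega>) \<partial>P x)"
    unfolding \<open>?L = ?R\<close> by (rule nn_integral_bind[OF f k])
  also have "\<dots> = (\<integral>\<^sup>+\<omega>. (\<integral>\<^sup>+z. f (\<omega>, z) \<partial>step_law (Xn \<omega> n)) \<partial>P x)"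
  proof (rule nn_integral_cong)
    fix \<omega> assume "\<omega> \<in> space (P x)"
    then have w: "\<omega> \<in> space (Filt E n)" by (simp add: space_Filt space_P x)
    have "Pair \<omega> \<in> step_law (Xn \<omega> n) \<rightarrow>\<^sub>M ?N"
      using measurable_Pair1'[OF w] by (simp add: measurable_cong_sets[OF sets_step_law refl])
    then show "(\<integral>\<^sup>+z. f z \<partial>?k \<omega>) = (\<integral>\<^sup>+z. f (\<omega>, z) \<partial>step_law (Xn \<omega> n))"
      using f by (simp add: nn_integral_distr)
  qed
  finally show ?thesis .
qed

text \<open>The kernel has no mass at time 0. Positivity matters because \<open>Xt\<close> skips
  states with sojourns of length zero: without it the state at time \<open>Sn \<omega> n\<close>
  could differ from \<open>Xn \<omega> n\<close>.\<close>

lemma AE_Tn_pos: assumes x: "x \<in> E" shows "AE \<omega> in P x. \<forall>n. 0 < Tn \<omega> (Suc n)"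
  unfolding AE_all_countable
proof
  fix n
  interpret prob_space "P x" using x by (rule prob_P)
  let ?Z = "{\<omega>\<in>space (P x). snd \<omega> n \<in> {0..0} \<times> E}"
  have top: "E \<in> sets (ME E)" "space (P x) \<in> sets (Filt E n)"
    using sets.top[of "ME E"] sets.top[of "Filt E n"] by (simp_all add: space_ME[OF E_borel] space_Filt space_P x)
  have Q0: "Q 0 E y = 0" if "y \<in> E" for y
    using Q_kernel top(1) that unfolding semi_Markov_kernel_def by blast
  have "measure (P x) (space (P x) \<inter> ?Z) = (\<integral>\<omega>. indicator (space (P x)) \<omega> * Q 0 E (Xn \<omega> n) \<partial>P x)"
    by (rule Q_law[OF x order_refl top])
  also have "\<dots> = (\<integral>\<omega>. 0 \<partial>P x)"
    by (intro Bochner_Integration.integral_cong) (auto simp: Q0 Xn_in_E[OF E_borel] space_P x)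
  finally have "prob ?Z = 0" by (simp add: Int_absorb1)
  moreover have "?Z \<in> events"
  proof -
    have "{0..0} \<times> E \<in> sets (MTE E)"
      using top(1) by (rule rect_sets)
    from measurable_sets[OF step_measurable[OF E_borel, of n] this] show ?thesis
      by (simp add: sets_P space_P x vimage_def Int_def conj_commute)
  qed
  ultimately have "AE \<omega> in P x. \<omega> \<notin> ?Z"
    by (subst (asm) prob_eq_0) auto
  with AE_space show "AE \<omega> in P x. 0 < Tn \<omega> (Suc n)"
  proof eventually_elim
    case (elim \<omega>)
    then show ?case
      using step_in_MTE[OF E_borel, of \<omega> n] by (auto simp: Tn_Suc space_P x mem_Times_iff)
  qed
qed

text \<open>Bound \<open>exp (- t)\<close> by 1 for t up to \<delta> and by
  \<open>exp (- \<delta>)\<close> afterwards, then integrate and use that the first case has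
  probability at most 1 - \<epsilon>. The result is \<beta> = 1 - \<epsilon> (1 - exp (-\<delta>));
  its independence of the state is what makes it usable at every step.\<close>

lemma exp_holding_time_le:
  "\<exists>\<beta>. 0 \<le> \<beta> \<and> \<beta> < 1 \<and> (\<forall>x\<in>E. (\<integral>\<^sup>+z. ennreal (exp (- fst z)) \<partial>step_law x) \<le> ennreal \<beta>)"
proof -
  obtain \<delta> \<epsilon> where d: "0 < \<delta>" and e: "0 < \<epsilon>" and reg: "\<And>x. x \<in> E \<Longrightarrow> Q \<delta> E x \<le> 1 - \<epsilon>"
    using regular by blast
  define \<beta> where "\<beta> = exp (- \<delta>) + (1 - exp (- \<delta>)) * (1 - \<epsilon>)"
  have top: "E \<in> sets (ME E)"
    using sets.top[of "ME E"] by (simp add: space_ME[OF E_borel])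
  \<comment> \<open>Any state shows that \<epsilon> is at most 1, since \<open>Q\<close> is
    nonnegative there; hence \<beta> is nonnegative.\<close>
  obtain x0 where "x0 \<in> E" using E_ne by blast
  then have "0 \<le> 1 - \<epsilon>"
    using Q_bounds(1)[of x0 \<delta> E] reg[of x0] d top by simp
  then have b0: "0 \<le> \<beta>" unfolding \<beta>_def using d by simp
  have "\<beta> = 1 - \<epsilon> * (1 - exp (- \<delta>))" by (simp add: \<beta>_def algebra_simps)
  then have b1: "\<beta> < 1" using d e by simp
  have "(\<integral>\<^sup>+z. ennreal (exp (- fst z)) \<partial>step_law x) \<le> ennreal \<beta>" if x: "x \<in> E" for x
  proof -
    interpret prob_space "step_law x" using x by (rule prob_step_law)
    have C: "{0..\<delta>} \<times> E \<in> sets (step_law x)"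
      unfolding sets_step_law using top by (rule rect_sets)
    have "(\<integral>\<^sup>+z. ennreal (exp (- fst z)) \<partial>step_law x)
      \<le> (\<integral>\<^sup>+z. ennreal (exp (- \<delta>)) + ennreal (1 - exp (- \<delta>)) * indicator ({0..\<delta>} \<times> E) z \<partial>step_law x)"
    proof (rule nn_integral_mono)
      fix z assume "z \<in> space (step_law x)"
      then have z: "0 \<le> fst z" "snd z \<in> E" by (auto simp: space_step_law)
      show "ennreal (exp (- fst z)) \<le> ennreal (exp (- \<delta>)) + ennreal (1 - exp (- \<delta>)) * indicator ({0..\<delta>} \<times> E) z"
      proof (cases "fst z \<le> \<delta>")
        case True
        then have "z \<in> {0..\<delta>} \<times> E" using z by (auto simp: mem_Times_iff)
        then show ?thesis using z d by (simp add: ennreal_plus[symmetric] ennreal_leI del: ennreal_plus)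
      next
        case False
        then show ?thesis by (auto intro!: order_trans[OF ennreal_leI add_increasing2])
      qed
    qed
    also have "\<dots> = ennreal (exp (- \<delta>)) + ennreal (1 - exp (- \<delta>)) * emeasure (step_law x) ({0..\<delta>} \<times> E)"
      using C by (simp add: nn_integral_add nn_integral_cmult emeasure_space_1)
    also have "\<dots> = ennreal (exp (- \<delta>) + (1 - exp (- \<delta>)) * Q \<delta> E x)"
      using d x top by (simp add: emeasure_step_law_rect Q_bounds ennreal_mult ennreal_plus)
    also have "\<dots> \<le> ennreal \<beta>"
      unfolding \<beta>_def using reg[OF x] d by (intro ennreal_leI add_left_mono mult_left_mono) auto
    finally show ?thesis .
  qed
  with b0 b1 show ?thesis by blast
qed

text \<open>The expectation of \<open>exp (- Sn \<omega> n)\<close> decays geometrically, so these terms are almost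
  surely summable.\<close>
lemma AE_no_explosion: assumes x: "x \<in> E" shows "AE \<omega> in P x. filterlim (Sn \<omega>) at_top sequentially"
proof -
  interpret prob_space "P x" using x by (rule prob_P)
  note [measurable_cong] = sets_P[OF x]
  obtain \<beta> where b: "0 \<le> \<beta>" "\<beta> < 1" "\<And>x. x \<in> E \<Longrightarrow> (\<integral>\<^sup>+z. ennreal (exp (- fst z)) \<partial>step_law x) \<le> ennreal \<beta>"
    using exp_holding_time_le by blast
  have bound: "(\<integral>\<^sup>+\<omega>. ennreal (exp (- Sn \<omega> n)) \<partial>P x) \<le> ennreal (\<beta> ^ n)" for n
  proof (induction n)
    case (Suc n)
    \<comment> \<open>The first factor depends on the history only; integrating the second against
      \<open>step_law\<close> costs at most a factor \<beta>.\<close>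
    let ?f = "\<lambda>(\<omega>, z). ennreal (exp (- Sn \<omega> n)) * ennreal (exp (- fst z))"
    have [measurable]: "(\<lambda>\<omega>. Sn \<omega> n) \<in> borel_measurable (Filt E n)" "fst \<in> borel_measurable (MTE E)"
      by (rule Sn_Filt_measurable[OF E_borel order_refl], rule fst_MTE_borel[OF E_borel])
    have "(\<integral>\<^sup>+\<omega>. ennreal (exp (- Sn \<omega> (Suc n))) \<partial>P x) = (\<integral>\<^sup>+\<omega>. ?f (\<omega>, snd \<omega> n) \<partial>P x)"
      by (intro nn_integral_cong) (simp add: Sn_Suc Tn_Suc mult_exp_exp flip: ennreal_mult)
    also have "\<dots> = (\<integral>\<^sup>+\<omega>. (\<integral>\<^sup>+z. ?f (\<omega>, z) \<partial>step_law (Xn \<omega> n)) \<partial>P x)"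
      by (rule Markov_property[OF x]) measurable
    also have "\<dots> \<le> (\<integral>\<^sup>+\<omega>. ennreal \<beta> * ennreal (exp (- Sn \<omega> n)) \<partial>P x)"
    proof (rule nn_integral_mono)
      fix \<omega> assume "\<omega> \<in> space (P x)"
      then have "Xn \<omega> n \<in> E" by (simp add: Xn_in_E[OF E_borel] space_P x)
      have "(\<integral>\<^sup>+z. ?f (\<omega>, z) \<partial>step_law (Xn \<omega> n)) = ennreal (exp (- Sn \<omega> n)) * (\<integral>\<^sup>+z. ennreal (exp (- fst z)) \<partial>step_law (Xn \<omega> n))"
        using sets_step_law[of "Xn \<omega> n"] by (simp add: nn_integral_cmult cong: measurable_cong_sets)
      also have "\<dots> \<le> ennreal (exp (- Sn \<omega> n)) * ennreal \<beta>"
        by (intro mult_left_mono b) (simp_all add: \<open>Xn \<omega> n \<in> E\<close>)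
      finally show "(\<integral>\<^sup>+z. ?f (\<omega>, z) \<partial>step_law (Xn \<omega> n)) \<le> ennreal \<beta> * ennreal (exp (- Sn \<omega> n))"
        by (simp add: mult.commute)
    qed
    also have "\<dots> = ennreal \<beta> * (\<integral>\<^sup>+\<omega>. ennreal (exp (- Sn \<omega> n)) \<partial>P x)"
      by (rule nn_integral_cmult) measurable
    also have "\<dots> \<le> ennreal \<beta> * ennreal (\<beta> ^ n)"
      by (intro mult_left_mono Suc) simp
    finally show ?case using b(1) by (simp add: ennreal_mult)
  qed (simp add: Sn_0 emeasure_space_1)
  have "(\<integral>\<^sup>+\<omega>. (\<Sum>n. ennreal (exp (- Sn \<omega> n))) \<partial>P x) = (\<Sum>n. \<integral>\<^sup>+\<omega>. ennreal (exp (- Sn \<omega> n)) \<partial>P x)"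
    by (rule nn_integral_suminf) measurable
  also have "\<dots> \<le> (\<Sum>n. ennreal (\<beta> ^ n))"
    by (intro suminf_le bound) auto
  also have "\<dots> < \<infinity>"
    using b by (subst suminf_ennreal2) (auto intro: summable_geometric)
  finally have "AE \<omega> in P x. (\<Sum>n. ennreal (exp (- Sn \<omega> n))) \<noteq> \<infinity>"
    by (intro nn_integral_PInf_AE) auto
  then show ?thesis
  proof eventually_elim
    case (elim \<omega>)
    then have "summable (\<lambda>n. exp (- Sn \<omega> n))"
      by (intro summable_suminf_not_top) auto
    then have "(\<lambda>n. exp (- Sn \<omega> n)) \<longlonglongrightarrow> 0" by (rule summable_LIMSEQ_zero)
    then have "filterlim (\<lambda>n. exp (- Sn \<omega> n)) (at_right 0) sequentially"
      by (simp add: filterlim_at)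
    then have "filterlim (\<lambda>n. ln (exp (- Sn \<omega> n))) at_bot sequentially"
      by (rule filterlim_compose[OF ln_at_0])
    then show ?case by (simp add: filterlim_uminus_at_top)
  qed
qed

end

section \<open>The reward as a sum of one-step costs\<close>

lemma Sn_mono: "(\<And>k. 0 \<le> Tn \<omega> k) \<Longrightarrow> m \<le> n \<Longrightarrow> Sn \<omega> m \<le> Sn \<omega> n"
  unfolding Sn_def by (intro sum_mono2) auto

lemma Xt_eq:
  assumes "\<And>k. 0 \<le> Tn \<omega> k" "Sn \<omega> n \<le> t" "t < Sn \<omega> (Suc n)"
  shows "Xt \<omega> t = Xn \<omega> n"
proof -
  have "(LEAST m. t < Sn \<omega> (Suc m)) = n"
  proof (rule Least_equality)
    fix m assume "t < Sn \<omega> (Suc m)"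
    then show "n \<le> m"
      using Sn_mono[of \<omega> "Suc m" n] assms by (force simp: not_less_eq_eq[symmetric])
  qed fact
  then show ?thesis by (simp add: Xt_def)
qed

text \<open>Without explosion each t in \<open>{0..<a}\<close> lies in exactly one sojourn interval,
  and the process is constant there; integrating interval by interval gives the series.\<close>

lemma running_cost_eq:
  assumes T: "\<And>k. 0 \<le> Tn \<omega> k" and lim: "filterlim (Sn \<omega>) at_top sequentially"
  shows "(\<integral>\<^sup>+t\<in>{0..<a}. ennreal (c (Xt \<omega> t)) \<partial>lborel)
    = (\<Sum>k. ennreal (c (Xn \<omega> k)) * ennreal (min (Tn \<omega> (Suc k)) (a - Sn \<omega> k)))"
proof -
  let ?I = "\<lambda>k. {Sn \<omega> k..<min (Sn \<omega> (Suc k)) a}"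
  have S0: "0 \<le> Sn \<omega> k" for k using Sn_mono[OF T, where m=0 and n=k] by (simp add: Sn_0)
  have "ennreal (c (Xt \<omega> t)) * indicator {0..<a} t = (\<Sum>k. ennreal (c (Xn \<omega> k)) * indicator (?I k) t)" for t
  proof (cases "t \<in> {0..<a}")
    case True
    have "eventually (\<lambda>n. t < Sn \<omega> n) sequentially"
      using lim by (simp add: filterlim_at_top_dense)
    then obtain m where "t < Sn \<omega> m" by (auto simp: eventually_sequentially)
    moreover have "\<not> t < Sn \<omega> 0" using True by (simp add: Sn_0)
    ultimately obtain n where n: "Sn \<omega> n \<le> t" "t < Sn \<omega> (Suc n)"
      using dec_induct[of 0 m "\<lambda>k. Sn \<omega> k \<le> t"] by (metis Sn_0 leI le0 not_le)
    have "k = n" if "t \<in> ?I k" for k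
      using that Sn_mono[OF T, where m="Suc n" and n=k] Sn_mono[OF T, where m="Suc k" and n=n] n
      by (cases k n rule: linorder_cases) (force simp: Suc_le_eq)+
    then have "ennreal (c (Xn \<omega> k)) * indicator (?I k) t = 0" if "k \<notin> {n}" for k
      using that by (auto simp: indicator_def)
    then have "(\<Sum>k. ennreal (c (Xn \<omega> k)) * indicator (?I k) t) = (\<Sum>k\<in>{n}. ennreal (c (Xn \<omega> k)) * indicator (?I k) t)"
      by (intro suminf_finite) auto
    also have "\<dots> = ennreal (c (Xn \<omega> n))" using n True by simp
    finally show ?thesis using True Xt_eq[OF T n] by simp
  next
    case False
    then have "t \<notin> ?I k" for k using S0[of k] by auto
    then show ?thesis using False by simp
  qed
  then have "(\<integral>\<^sup>+t\<in>{0..<a}. ennreal (c (Xt \<omega> t)) \<partial>lborel)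
      = (\<integral>\<^sup>+t. (\<Sum>k. ennreal (c (Xn \<omega> k)) * indicator (?I k) t) \<partial>lborel)"
    by simp
  also have "\<dots> = (\<Sum>k. \<integral>\<^sup>+t. ennreal (c (Xn \<omega> k)) * indicator (?I k) t \<partial>lborel)"
    by (rule nn_integral_suminf) simp
  also have "\<dots> = (\<Sum>k. ennreal (c (Xn \<omega> k)) * ennreal (min (Tn \<omega> (Suc k)) (a - Sn \<omega> k)))"
  proof (rule suminf_cong)
    fix k
    \<comment> \<open>If \<open>Sn \<omega> k\<close> exceeds a, the interval is empty and
      \<open>ennreal\<close> sends the negative length to 0.\<close>
    have "emeasure lborel (?I k) = ennreal (min (Tn \<omega> (Suc k)) (a - Sn \<omega> k))"
      using T[of "Suc k"] by (cases "Sn \<omega> k \<le> a") (auto simp: Sn_Suc min_def ennreal_neg)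
    then show "(\<integral>\<^sup>+t. ennreal (c (Xn \<omega> k)) * indicator (?I k) t \<partial>lborel)
        = ennreal (c (Xn \<omega> k)) * ennreal (min (Tn \<omega> (Suc k)) (a - Sn \<omega> k))"
      by (simp add: nn_integral_cmult)
  qed
  finally show ?thesis .
qed

text \<open>With \<open>step_cost\<close> this splits the reward by step index into terms that
  depend on finitely many coordinates and the stopping decision, ready for the Markov
  property.\<close>

definition stop_cost :: "('a \<Rightarrow> real) \<Rightarrow> real \<Rightarrow> ('a path \<Rightarrow> enat) \<Rightarrow> nat \<Rightarrow> 'a path \<Rightarrow> ennreal" where
  "stop_cost g s \<tau> k \<omega> = (if \<tau> \<omega> = enat k \<and> Sn \<omega> k < s then ennreal (g (Xn \<omega> k)) else 0)"

text \<open>Past the horizon \<open>s - Sn \<omega> k\<close> is negative and \<open>ennreal\<close> maps it to 0, which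
  truncates the running cost at s.\<close>
definition step_cost :: "('a \<Rightarrow> real) \<Rightarrow> real \<Rightarrow> ('a path \<Rightarrow> enat) \<Rightarrow> nat \<Rightarrow> 'a path \<Rightarrow> ennreal" where
  "step_cost c s \<tau> k \<omega> = (if enat k < \<tau> \<omega>
     then ennreal (c (Xn \<omega> k)) * ennreal (min (Tn \<omega> (Suc k)) (s - Sn \<omega> k)) else 0)"

text \<open>Positive holding times give X(S_n) = X_n, so the terminal cost is charged at the right
  state. The running costs are compared term by term with \<open>running_cost_eq\<close>, whose
  upper limit is the smaller of the stopping time and the horizon.\<close>

lemma Reward_eq_suminf:
  assumes T0: "Tn \<omega> 0 = 0" and T: "\<And>k. 0 < Tn \<omega> (Suc k)"
    and lim: "filterlim (Sn \<omega>) at_top sequentially"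
  shows "Reward c g s \<tau> \<omega> = (\<Sum>k. stop_cost g s \<tau> k \<omega> + step_cost c s \<tau> k \<omega>)"
proof -
  have T': "0 \<le> Tn \<omega> k" for k
    using T0 T by (cases k) (auto intro: less_imp_le)
  note mono = Sn_mono[of \<omega>, OF T']
  let ?stop = "\<lambda>k. stop_cost g s \<tau> k \<omega>" and ?step = "\<lambda>k. step_cost c s \<tau> k \<omega>"
  have split: "(\<Sum>k. ?stop k + ?step k) = suminf ?stop + suminf ?step"
    by (rule suminf_add[symmetric]) auto
  show ?thesis
  proof (cases "\<tau> \<omega>")
    case (enat n)
    show ?thesis
    proof (cases "Sn \<omega> n < s")
      case True
      have "suminf ?stop = (\<Sum>k\<in>{n}. ?stop k)"
        by (rule suminf_finite) (auto simp: stop_cost_def enat)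
      also have "\<dots> = ennreal (g (Xt \<omega> (Sn \<omega> n)))"
        using True enat Xt_eq[of \<omega>, OF T', of n "Sn \<omega> n"] T[of n] by (simp add: stop_cost_def Sn_Suc)
      finally have stop: "suminf ?stop = ennreal (g (Xt \<omega> (Sn \<omega> n)))" .
      have "suminf ?step = (\<integral>\<^sup>+t\<in>{0..<Sn \<omega> n}. ennreal (c (Xt \<omega> t)) \<partial>lborel)"
        unfolding running_cost_eq[OF T' lim]
      proof (rule suminf_cong)
        fix k
        show "?step k = ennreal (c (Xn \<omega> k)) * ennreal (min (Tn \<omega> (Suc k)) (Sn \<omega> n - Sn \<omega> k))"
        proof (cases "k < n")
          case True
          then show ?thesis
            using mono[of "Suc k" n] \<open>Sn \<omega> n < s\<close> enat by (simp add: step_cost_def Sn_Suc min_absorb1)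
        next
          \<comment> \<open>Here k is at least n: no step cost is charged, and on the right
            \<open>Sn \<omega> n - Sn \<omega> k\<close> is at most 0.\<close>
          case False
          then show ?thesis
            using mono[of n k] enat by (simp add: step_cost_def ennreal_neg min.coboundedI2)
        qed
      qed
      then show ?thesis
        unfolding Reward_def split stop using True enat by (simp add: Stau_def add.commute)
    next
      case False
      have "?stop = (\<lambda>k. 0)" using False enat by (auto simp: stop_cost_def)
      then have "suminf ?stop = 0" by simp
      moreover have "suminf ?step = (\<integral>\<^sup>+t\<in>{0..<s}. ennreal (c (Xt \<omega> t)) \<partial>lborel)"
        unfolding running_cost_eq[OF T' lim]
      proof (rule suminf_cong)
        fix k
        show "?step k = ennreal (c (Xn \<omega> k)) * ennreal (min (Tn \<omega> (Suc k)) (s - Sn \<omega> k))"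
          using mono[of n k] enat False
          by (cases "k < n") (auto simp: step_cost_def ennreal_neg min.coboundedI2)
      qed
      ultimately show ?thesis
        unfolding Reward_def split using False enat by (simp add: Stau_def)
    qed
  next
    case infinity
    \<comment> \<open>A path that never stops passes the horizon, so only the running cost up to s
      remains.\<close>
    obtain n where "s < Sn \<omega> n"
      using lim by (auto simp: filterlim_at_top_dense eventually_sequentially)
    then have "ereal s \<le> (SUP n. ereal (Sn \<omega> n))"
      by (intro SUP_upper2[of n]) auto
    then have "\<not> (SUP n. ereal (Sn \<omega> n)) < ereal s"
      by (simp add: not_less)
    moreover have "suminf ?stop = 0" using infinity by (simp add: stop_cost_def)
    ultimately show ?thesis
      unfolding Reward_def split running_cost_eq[OF T' lim]
      using infinity by (simp add: Stau_def step_cost_def)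
  qed
qed

section \<open>Value iteration\<close>

text \<open>The bound \<open>Suc n\<close> in the second claim is predictability: whether \<tau> is
  at least k is decided by the events that it equals some j < k. The third claim is the second at
  \<open>Suc k\<close>.\<close>

lemma stopping_time_measurable:
  assumes "is_stopping_time E \<tau>"
  shows "k \<le> n \<Longrightarrow> Measurable.pred (Filt E n) (\<lambda>\<omega>. \<tau> \<omega> = enat k)"
    and "k \<le> Suc n \<Longrightarrow> Measurable.pred (Filt E n) (\<lambda>\<omega>. enat k \<le> \<tau> \<omega>)"
    and "k \<le> n \<Longrightarrow> Measurable.pred (Filt E n) (\<lambda>\<omega>. enat k < \<tau> \<omega>)"
proof -
  have eq: "Measurable.pred (Filt E n) (\<lambda>\<omega>. \<tau> \<omega> = enat k)" if "k \<le> n" for k n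
    unfolding pred_def space_Filt
    using assms that by (intro sets_Filt_mono[OF that]) (simp add: is_stopping_time_def)
  have ge: "Measurable.pred (Filt E n) (\<lambda>\<omega>. enat k \<le> \<tau> \<omega>)" if "k \<le> Suc n" for k n
  proof -
    have iff: "enat k \<le> \<tau> \<omega> \<longleftrightarrow> (\<forall>j\<in>{..<k}. \<tau> \<omega> \<noteq> enat j)" for \<omega>
      by (cases "\<tau> \<omega>") (auto simp: not_less[symmetric])
    show ?thesis
      unfolding iff using that by (intro pred_intros_finite pred_intros_logic eq) auto
  qed
  show "k \<le> n \<Longrightarrow> Measurable.pred (Filt E n) (\<lambda>\<omega>. \<tau> \<omega> = enat k)" by (rule eq)
  show "k \<le> Suc n \<Longrightarrow> Measurable.pred (Filt E n) (\<lambda>\<omega>. enat k \<le> \<tau> \<omega>)" by (rule ge)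
  show "Measurable.pred (Filt E n) (\<lambda>\<omega>. enat k < \<tau> \<omega>)" if "k \<le> n"
    using ge[of "Suc k" n] that by (simp add: Suc_ile_eq)
qed

lemma enat_Least_eq_enat: "enat_Least p = enat n \<longleftrightarrow> p n \<and> (\<forall>k<n. \<not> p k)"
proof
  show "enat_Least p = enat n \<Longrightarrow> p n \<and> (\<forall>k<n. \<not> p k)"
    by (auto simp: enat_Least_def split: if_splits intro: LeastI dest: not_less_Least)
  assume n: "p n \<and> (\<forall>k<n. \<not> p k)"
  then have "Least p = n" by (intro Least_equality) (auto simp: not_less[symmetric])
  then show "enat_Least p = enat n" using n by (auto simp: enat_Least_def)
qed

text \<open>Merges the two infima in \<open>tau_star\<close> into one first entrance time.\<close>

lemma enat_Least_min: "min (enat_Least p) (enat_Least q) = enat_Least (\<lambda>n. p n \<or> q n)"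
proof (rule antisym)
  have le: "enat_Least p' \<le> enat n" if "p' n" for p' n
    using that by (auto simp: enat_Least_def intro: Least_le)
  show "min (enat_Least p) (enat_Least q) \<le> enat_Least (\<lambda>n. p n \<or> q n)"
  proof (cases "enat_Least (\<lambda>n. p n \<or> q n)")
    case (enat n)
    then have "p n \<or> q n" by (simp add: enat_Least_eq_enat)
    then show ?thesis using enat le[of p n] le[of q n] by (auto simp: min_le_iff_disj)
  qed simp
  have "enat_Least (\<lambda>n. p n \<or> q n) \<le> enat_Least p'" if "\<And>n. p' n \<Longrightarrow> p n \<or> q n" for p'
  proof (cases "enat_Least p'")
    case (enat n)
    then have "p' n" by (simp add: enat_Least_eq_enat)
    then have "enat_Least (\<lambda>n. p n \<or> q n) \<le> enat n" by (intro le that)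
    then show ?thesis by (simp only: enat)
  qed simp
  then show "enat_Least (\<lambda>n. p n \<or> q n) \<le> min (enat_Least p) (enat_Least q)" by simp
qed

locale semi_Markov_stopping = semi_Markov +
  fixes c g :: "'a \<Rightarrow> real"
  assumes c_meas: "c \<in> borel_measurable (ME E)" and g_meas: "g \<in> borel_measurable (ME E)"
begin

text \<open>The Bellman operator for continuing through one transition. The remaining horizon
  \<open>r - fst z\<close> may be negative, so u takes arbitrary real horizons; the iterates below
  vanish at nonpositive ones.\<close>

definition step_op :: "(real \<Rightarrow> 'a \<Rightarrow> ennreal) \<Rightarrow> real \<Rightarrow> 'a \<Rightarrow> ennreal" where
  "step_op u r x = (\<integral>\<^sup>+z. ennreal (c x) * ennreal (min (fst z) r) + u (r - fst z) (snd z) \<partial>step_law x)"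

primrec value_iter :: "nat \<Rightarrow> real \<Rightarrow> 'a \<Rightarrow> ennreal" where
  "value_iter 0 r x = 0"
| "value_iter (Suc n) r x = (if r \<le> 0 then 0 else min (ennreal (g x)) (step_op (value_iter n) r x))"

definition value_lim :: "real \<Rightarrow> 'a \<Rightarrow> ennreal" where
  "value_lim r x = (SUP n. value_iter n r x)"

text \<open>Joint measurability is needed because along a path both the remaining horizon and the
  state are random.\<close>

abbreviation horizon_measurable :: "(real \<Rightarrow> 'a \<Rightarrow> ennreal) \<Rightarrow> bool" where
  "horizon_measurable u \<equiv> case_prod u \<in> borel_measurable (borel \<Otimes>\<^sub>M ME E)"

lemma horizon_measurable_compose:
  assumes "horizon_measurable u" "f \<in> borel_measurable M" "h \<in> M \<rightarrow>\<^sub>M ME E"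
  shows "(\<lambda>y. u (f y) (h y)) \<in> borel_measurable M"
  using measurable_compose[OF measurable_Pair[OF assms(2,3)] assms(1)] by simp

lemma step_op_integrand_measurable:
  assumes u: "horizon_measurable u"
  shows "(\<lambda>(p, z). ennreal (c (snd p)) * ennreal (min (fst z) (fst p)) + u (fst p - fst z) (snd z))
    \<in> borel_measurable ((borel \<Otimes>\<^sub>M ME E) \<Otimes>\<^sub>M MTE E)"
proof -
  have [measurable]: "(\<lambda>q. fst (snd q)) \<in> borel_measurable ((borel \<Otimes>\<^sub>M ME E) \<Otimes>\<^sub>M MTE E)"
    "(\<lambda>q. fst (fst q)) \<in> borel_measurable ((borel \<Otimes>\<^sub>M ME E) \<Otimes>\<^sub>M MTE E)"
    "(\<lambda>q. snd (snd q)) \<in> (borel \<Otimes>\<^sub>M ME E) \<Otimes>\<^sub>M MTE E \<rightarrow>\<^sub>M ME E"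
    "(\<lambda>q. snd (fst q)) \<in> (borel \<Otimes>\<^sub>M ME E) \<Otimes>\<^sub>M MTE E \<rightarrow>\<^sub>M ME E"
    by (rule measurable_compose[OF measurable_snd fst_MTE_borel[OF E_borel]]
          measurable_compose[OF measurable_fst measurable_fst]
          measurable_compose[OF measurable_snd snd_MTE_measurable[OF E_borel]]
          measurable_compose[OF measurable_fst measurable_snd])+
  have [measurable]: "(\<lambda>q. u (fst (fst q) - fst (snd q)) (snd (snd q))) \<in> borel_measurable ((borel \<Otimes>\<^sub>M ME E) \<Otimes>\<^sub>M MTE E)"
    by (rule horizon_measurable_compose[OF u]) measurable
  have [measurable]: "(\<lambda>q. c (snd (fst q))) \<in> borel_measurable ((borel \<Otimes>\<^sub>M ME E) \<Otimes>\<^sub>M MTE E)"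
    by (rule measurable_compose[OF _ c_meas]) measurable
  show ?thesis unfolding case_prod_beta by measurable
qed

lemma step_op_section_measurable:
  assumes "horizon_measurable u" "x \<in> E"
  shows "(\<lambda>z. ennreal (c x) * ennreal (min (fst z) r) + u (r - fst z) (snd z)) \<in> borel_measurable (step_law x)"
  using measurable_compose[OF measurable_Pair1'[of "(r, x)" "borel \<Otimes>\<^sub>M ME E" "MTE E"] step_op_integrand_measurable[OF assms(1)]] assms(2)
  by (simp add: measurable_cong_sets[OF sets_step_law refl] space_pair_measure space_ME[OF E_borel])

lemma step_op_measurable: "horizon_measurable u \<Longrightarrow> horizon_measurable (step_op u)"
  unfolding step_op_def case_prod_beta
  by (rule nn_integral_measurable_subprob_algebra2[OF step_op_integrand_measurable])
    (auto intro: measurable_compose[OF measurable_snd step_law_measurable])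

lemma value_iter_measurable: "horizon_measurable (value_iter n)"
proof (induction n)
  case (Suc n)
  have [measurable]: "(\<lambda>p. step_op (value_iter n) (fst p) (snd p)) \<in> borel_measurable (borel \<Otimes>\<^sub>M ME E)"
    using step_op_measurable[OF Suc] by (simp add: case_prod_beta')
  have [measurable]: "(\<lambda>p. g (snd p)) \<in> borel_measurable (borel \<Otimes>\<^sub>M ME E)"
    by (rule measurable_compose[OF measurable_snd g_meas])
  have "(\<lambda>p. if fst p \<le> (0::real) then 0 else min (ennreal (g (snd p))) (step_op (value_iter n) (fst p) (snd p)))
      \<in> borel_measurable (borel \<Otimes>\<^sub>M ME E)"
    by measurable
  then show ?case by (simp add: case_prod_beta')
qed (simp add: case_prod_beta')

lemma value_lim_measurable: "horizon_measurable value_lim"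
proof -
  have "(\<lambda>p. SUP n. value_iter n (fst p) (snd p)) \<in> borel_measurable (borel \<Otimes>\<^sub>M ME E)"
    using value_iter_measurable by (intro borel_measurable_SUP) (simp_all add: case_prod_beta')
  then show ?thesis by (simp add: value_lim_def case_prod_beta')
qed

lemma step_op_mono: "(\<And>r y. u r y \<le> v r y) \<Longrightarrow> step_op u r x \<le> step_op v r x"
  unfolding step_op_def by (intro nn_integral_mono add_left_mono)

lemma value_iter_mono: "value_iter n r x \<le> value_iter (Suc n) r x"
proof (induction n arbitrary: r x)
  case (Suc n)
  have "step_op (value_iter n) r x \<le> step_op (value_iter (Suc n)) r x" by (rule step_op_mono) (rule Suc)
  then show ?case
    by (subst (1 2) value_iter.simps(2)) (auto simp del: value_iter.simps intro: min.coboundedI2)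
qed simp

text \<open>The iterates increase, so monotone convergence moves the supremum out of the integral;
  the minimum with the fixed number \<open>g x\<close> commutes with suprema as well.\<close>

lemma value_lim_fixpoint:
  assumes x: "x \<in> E" and r: "0 < r"
  shows "value_lim r x = min (ennreal (g x)) (step_op value_lim r x)"
proof -
  have step_op: "step_op value_lim r x = (SUP n. step_op (value_iter n) r x)"
  proof -
    have "step_op value_lim r x = (\<integral>\<^sup>+z. (SUP n. ennreal (c x) * ennreal (min (fst z) r) + value_iter n (r - fst z) (snd z)) \<partial>step_law x)"
      unfolding step_op_def value_lim_def by (simp add: ennreal_SUP_add_right)
    also have "\<dots> = (SUP n. step_op (value_iter n) r x)"
      unfolding step_op_def
      using value_iter_mono by (intro nn_integral_monotone_convergence_SUP step_op_section_measurable value_iter_measurable x)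
        (auto intro!: incseq_SucI le_funI add_left_mono simp del: value_iter.simps)
    finally show ?thesis .
  qed
  \<comment> \<open>Omitting the zeroth iterate keeps the supremum and lets the recursion be
    unfolded in every term.\<close>
  have "value_lim r x = (SUP n. value_iter (Suc n) r x)"
    unfolding value_lim_def
    by (rule antisym; rule SUP_mono) (use value_iter_mono in \<open>auto simp del: value_iter.simps\<close>)
  also have "\<dots> = (SUP n. inf (ennreal (g x)) (step_op (value_iter n) r x))"
    using r by (simp add: inf_min)
  also have "\<dots> = min (ennreal (g x)) (step_op value_lim r x)"
    unfolding step_op inf_min[symmetric] by (rule inf_SUP[symmetric])
  finally show ?thesis .
qed

section \<open>Adapted costs and the one-step identity\<close>

lemma stop_cost_measurable:
  assumes "is_stopping_time E \<tau>"
  shows "stop_cost g s \<tau> k \<in> borel_measurable (Filt E k)"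
proof -
  note [measurable] = stopping_time_measurable(1)[OF assms order_refl] Sn_Filt_measurable[OF E_borel order_refl]
    measurable_compose[OF Xn_Filt_measurable[OF E_borel order_refl] g_meas]
  show ?thesis unfolding stop_cost_def[abs_def] by measurable
qed

lemma value_step_measurable:
  assumes "is_stopping_time E \<tau>" "horizon_measurable u"
  shows "(\<lambda>\<omega>. if enat k < \<tau> \<omega> then u (s - Sn \<omega> k) (Xn \<omega> k) else 0) \<in> borel_measurable (Filt E k)"
    and "(\<lambda>\<omega>. if enat k \<le> \<tau> \<omega> then u (s - Sn \<omega> k) (Xn \<omega> k) else 0) \<in> borel_measurable (Filt E k)"
proof -
  note [measurable] = stopping_time_measurable(3)[OF assms(1) order_refl]
    stopping_time_measurable(2)[OF assms(1) le_SucI[OF order_refl]] Sn_Filt_measurable[OF E_borel order_refl]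
  have [measurable]: "(\<lambda>\<omega>. u (s - Sn \<omega> k) (Xn \<omega> k)) \<in> borel_measurable (Filt E k)"
    by (rule horizon_measurable_compose[OF assms(2) _ Xn_Filt_measurable[OF E_borel order_refl]]) measurable
  show "(\<lambda>\<omega>. if enat k < \<tau> \<omega> then u (s - Sn \<omega> k) (Xn \<omega> k) else 0) \<in> borel_measurable (Filt E k)"
    "(\<lambda>\<omega>. if enat k \<le> \<tau> \<omega> then u (s - Sn \<omega> k) (Xn \<omega> k) else 0) \<in> borel_measurable (Filt E k)"
    by measurable
qed

lemma Filt_P_measurable: "x \<in> E \<Longrightarrow> f \<in> borel_measurable (Filt E n) \<Longrightarrow> f \<in> borel_measurable (P x)"
  by (subst measurable_cong_sets[OF sets_P refl], assumption) (rule measurable_compose[OF Filt_in_Omega])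

lemma step_cost_measurable:
  assumes "is_stopping_time E \<tau>"
  shows "step_cost c s \<tau> k \<in> borel_measurable (Filt E (Suc k))"
proof -
  have k: "k \<le> Suc k" by simp
  note [measurable] = stopping_time_measurable(3)[OF assms k] Sn_Filt_measurable[OF E_borel k]
    Tn_Filt_measurable[OF E_borel order_refl] measurable_compose[OF Xn_Filt_measurable[OF E_borel k] c_meas]
  show ?thesis unfolding step_cost_def[abs_def] by measurable
qed

text \<open>The event of continuing past k belongs to \<open>Filt E k\<close>; on it the conditional
  expectation of the step cost plus u at the next state is \<open>step_op u\<close> at the current
  one. Being an equality for arbitrary u, it serves both the lower and the upper bound.\<close>

lemma one_step:
  assumes x: "x \<in> E" and \<tau>: "is_stopping_time E \<tau>" and u: "horizon_measurable u"
  shows "(\<integral>\<^sup>+\<omega>. stop_cost g s \<tau> k \<omega> + step_cost c s \<tau> k \<omega> \<partial>P x)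
       + (\<integral>\<^sup>+\<omega>. (if enat (Suc k) \<le> \<tau> \<omega> then u (s - Sn \<omega> (Suc k)) (Xn \<omega> (Suc k)) else 0) \<partial>P x)
     = (\<integral>\<^sup>+\<omega>. stop_cost g s \<tau> k \<omega> + (if enat k < \<tau> \<omega> then step_op u (s - Sn \<omega> k) (Xn \<omega> k) else 0) \<partial>P x)"
    (is "?A + ?B = ?C")
proof -
  let ?f = "\<lambda>(\<omega>, z). if enat k < \<tau> \<omega> then ennreal (c (Xn \<omega> k)) * ennreal (min (fst z) (s - Sn \<omega> k))
    + u (s - Sn \<omega> k - fst z) (snd z) else 0"
  have f: "?f \<in> borel_measurable (Filt E k \<Otimes>\<^sub>M MTE E)"
  proof -
    have [measurable]: "Measurable.pred (Filt E k \<Otimes>\<^sub>M MTE E) (\<lambda>q. enat k < \<tau> (fst q))"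
      by (rule measurable_compose[OF measurable_fst stopping_time_measurable(3)[OF \<tau> order_refl]])
    have "(\<lambda>q. ((s - Sn (fst q) k, Xn (fst q) k), snd q)) \<in> Filt E k \<Otimes>\<^sub>M MTE E \<rightarrow>\<^sub>M (borel \<Otimes>\<^sub>M ME E) \<Otimes>\<^sub>M MTE E"
      by (intro measurable_Pair measurable_snd borel_measurable_diff measurable_const
          measurable_compose[OF measurable_fst Sn_Filt_measurable[OF E_borel order_refl]]
          measurable_compose[OF measurable_fst Xn_Filt_measurable[OF E_borel order_refl]]) simp
    from measurable_compose[OF this step_op_integrand_measurable[OF u]]
    have [measurable]: "(\<lambda>q. ennreal (c (Xn (fst q) k)) * ennreal (min (fst (snd q)) (s - Sn (fst q) k))
        + u (s - Sn (fst q) k - fst (snd q)) (snd (snd q))) \<in> borel_measurable (Filt E k \<Otimes>\<^sub>M MTE E)"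
      by simp
    show ?thesis unfolding case_prod_beta' by measurable
  qed
  have m: "stop_cost g s \<tau> k \<in> borel_measurable (P x)" "step_cost c s \<tau> k \<in> borel_measurable (P x)"
    "(\<lambda>\<omega>. if enat (Suc k) \<le> \<tau> \<omega> then u (s - Sn \<omega> (Suc k)) (Xn \<omega> (Suc k)) else 0) \<in> borel_measurable (P x)"
    "(\<lambda>\<omega>. if enat k < \<tau> \<omega> then step_op u (s - Sn \<omega> k) (Xn \<omega> k) else 0) \<in> borel_measurable (P x)"
    by (rule Filt_P_measurable[OF x], rule stop_cost_measurable step_cost_measurable value_step_measurable step_op_measurable, (rule \<tau> u step_op_measurable)+)+
  have "?A + ?B = (\<integral>\<^sup>+\<omega>. stop_cost g s \<tau> k \<omega> \<partial>P x) + (\<integral>\<^sup>+\<omega>. step_cost c s \<tau> k \<omega>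
      + (if enat (Suc k) \<le> \<tau> \<omega> then u (s - Sn \<omega> (Suc k)) (Xn \<omega> (Suc k)) else 0) \<partial>P x)"
    using m by (simp add: nn_integral_add add.assoc)
  also have "(\<integral>\<^sup>+\<omega>. step_cost c s \<tau> k \<omega>
      + (if enat (Suc k) \<le> \<tau> \<omega> then u (s - Sn \<omega> (Suc k)) (Xn \<omega> (Suc k)) else 0) \<partial>P x) = (\<integral>\<^sup>+\<omega>. ?f (\<omega>, snd \<omega> k) \<partial>P x)"
    by (intro nn_integral_cong) (simp add: step_cost_def Suc_ile_eq Sn_Suc Tn_Suc Xn_Suc diff_diff_eq)
  also have "\<dots> = (\<integral>\<^sup>+\<omega>. (\<integral>\<^sup>+z. ?f (\<omega>, z) \<partial>step_law (Xn \<omega> k)) \<partial>P x)"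
    by (rule Markov_property[OF x f])
  also have "\<dots> = (\<integral>\<^sup>+\<omega>. (if enat k < \<tau> \<omega> then step_op u (s - Sn \<omega> k) (Xn \<omega> k) else 0) \<partial>P x)"
    by (intro nn_integral_cong) (simp add: step_op_def)
  also have "(\<integral>\<^sup>+\<omega>. stop_cost g s \<tau> k \<omega> \<partial>P x) + \<dots> = ?C"
    using m by (simp add: nn_integral_add)
  finally show ?thesis .
qed

lemma Vtau_eq_suminf:
  assumes x: "x \<in> E" and \<tau>: "is_stopping_time E \<tau>"
  shows "Vtau P c g \<tau> s x = (\<Sum>k. \<integral>\<^sup>+\<omega>. stop_cost g s \<tau> k \<omega> + step_cost c s \<tau> k \<omega> \<partial>P x)"
proof -
  have "Vtau P c g \<tau> s x = (\<integral>\<^sup>+\<omega>. (\<Sum>k. stop_cost g s \<tau> k \<omega> + step_cost c s \<tau> k \<omega>) \<partial>P x)"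
    unfolding Vtau_def
  proof (rule nn_integral_cong_AE)
    show "AE \<omega> in P x. Reward c g s \<tau> \<omega> = (\<Sum>k. stop_cost g s \<tau> k \<omega> + step_cost c s \<tau> k \<omega>)"
      using AE_Tn_pos[OF x] AE_no_explosion[OF x]
      by eventually_elim (rule Reward_eq_suminf; simp add: Tn_def)
  qed
  also have "\<dots> = (\<Sum>k. \<integral>\<^sup>+\<omega>. stop_cost g s \<tau> k \<omega> + step_cost c s \<tau> k \<omega> \<partial>P x)"
    using Filt_P_measurable[OF x stop_cost_measurable[OF \<tau>]] Filt_P_measurable[OF x step_cost_measurable[OF \<tau>]]
    by (intro nn_integral_suminf borel_measurable_add)
  finally show ?thesis .
qed

section \<open>Lower bound for every stopping time\<close>

lemma value_at_0:
  assumes x: "x \<in> E" and u: "horizon_measurable u"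
  shows "(\<integral>\<^sup>+\<omega>. (if enat 0 \<le> \<tau> \<omega> then u (s - Sn \<omega> 0) (Xn \<omega> 0) else 0) \<partial>P x) = u s x"
proof -
  interpret prob_space "P x" using x by (rule prob_P)
  have "(\<integral>\<^sup>+\<omega>. (if enat 0 \<le> \<tau> \<omega> then u (s - Sn \<omega> 0) (Xn \<omega> 0) else 0) \<partial>P x) = (\<integral>\<^sup>+\<omega>. u s x \<partial>P x)"
    using AE_start[OF x] by (intro nn_integral_cong_AE) (auto simp: Sn_0 zero_enat_def[symmetric])
  then show ?thesis by (simp add: emeasure_space_1)
qed

text \<open>An iterate is at most \<open>g\<close> and at most the continuation cost, so neither
  stopping nor continuing can beat it in one step; \<open>one_step\<close> and telescoping add up
  these inequalities.\<close>

lemma value_iter_le_Vtau: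
  assumes x: "x \<in> E" and \<tau>: "is_stopping_time E \<tau>"
  shows "value_iter N s x \<le> Vtau P c g \<tau> s x"
proof -
  define w where "w k = (\<integral>\<^sup>+\<omega>. (if enat k \<le> \<tau> \<omega> then value_iter (N - k) (s - Sn \<omega> k) (Xn \<omega> k) else 0) \<partial>P x)" for k
  define a where "a k = (\<integral>\<^sup>+\<omega>. stop_cost g s \<tau> k \<omega> + step_cost c s \<tau> k \<omega> \<partial>P x)" for k
  have step: "w k \<le> a k + w (Suc k)" if "k < N" for k
  proof -
    from that obtain n where n: "N - k = Suc n" "N - Suc k = n" by (metis Suc_diff_Suc)
    have "w k \<le> (\<integral>\<^sup>+\<omega>. stop_cost g s \<tau> k \<omega> + (if enat k < \<tau> \<omega> then step_op (value_iter n) (s - Sn \<omega> k) (Xn \<omega> k) else 0) \<partial>P x)"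
      unfolding w_def n stop_cost_def
    proof (rule nn_integral_mono)
      fix \<omega>
      have iff: "enat k \<le> \<tau> \<omega> \<longleftrightarrow> \<tau> \<omega> = enat k \<or> enat k < \<tau> \<omega>" by auto
      show "(if enat k \<le> \<tau> \<omega> then value_iter (Suc n) (s - Sn \<omega> k) (Xn \<omega> k) else 0)
        \<le> (if \<tau> \<omega> = enat k \<and> Sn \<omega> k < s then ennreal (g (Xn \<omega> k)) else 0)
          + (if enat k < \<tau> \<omega> then step_op (value_iter n) (s - Sn \<omega> k) (Xn \<omega> k) else 0)"
        unfolding iff by auto
    qed
    also have "\<dots> = a k + w (Suc k)"
      unfolding a_def w_def n by (rule one_step[OF x \<tau> value_iter_measurable, symmetric])
    finally show ?thesis .
  qed
  have "w 0 \<le> sum a {..<n} + w n" if "n \<le> N" for n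
    using that
  proof (induction n)
    case (Suc n)
    then have "w 0 \<le> sum a {..<n} + w n" by simp
    also have "\<dots> \<le> sum a {..<n} + (a n + w (Suc n))"
      using Suc.prems by (intro add_left_mono step) simp
    finally show ?case by (simp add: add.assoc)
  qed simp
  \<comment> \<open>At k = N the remainder is built from \<open>value_iter 0\<close> and is
    zero.\<close>
  from this[of N] have "w 0 \<le> sum a {..<N}" by (simp add: w_def cong: if_cong)
  also have "\<dots> \<le> suminf a" by (intro sum_le_suminf) auto
  also have "w 0 = value_iter N s x"
    unfolding w_def using value_at_0[OF x value_iter_measurable[of N], of \<tau> s] by (simp only: diff_zero)
  finally show ?thesis
    by (simp add: a_def[abs_def] Vtau_eq_suminf[OF x \<tau>])
qed

lemma value_lim_le_Vtau: "x \<in> E \<Longrightarrow> is_stopping_time E \<tau> \<Longrightarrow> value_lim s x \<le> Vtau P c g \<tau> s x"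
  unfolding value_lim_def by (intro SUP_least value_iter_le_Vtau)

text \<open>The condition behind \<open>tau_star\<close>, with \<open>value_lim\<close> in place of
  \<open>Vstar\<close>: measurability, and hence the stopping time property, is then available
  before the two are known to agree.\<close>

definition stop_now :: "real \<Rightarrow> 'a path \<Rightarrow> nat \<Rightarrow> bool" where
  "stop_now s \<omega> n \<longleftrightarrow> s \<le> Sn \<omega> n \<or> value_lim (s - Sn \<omega> n) (Xn \<omega> n) = ennreal (g (Xn \<omega> n))"

definition first_stop :: "real \<Rightarrow> 'a path \<Rightarrow> enat" where
  "first_stop s \<omega> = enat_Least (stop_now s \<omega>)"

lemma stop_now_measurable: "k \<le> n \<Longrightarrow> Measurable.pred (Filt E n) (\<lambda>\<omega>. stop_now s \<omega> k)"
proof -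
  assume k: "k \<le> n"
  note [measurable] = Sn_Filt_measurable[OF E_borel k] measurable_compose[OF Xn_Filt_measurable[OF E_borel k] g_meas]
  have [measurable]: "(\<lambda>\<omega>. value_lim (s - Sn \<omega> k) (Xn \<omega> k)) \<in> borel_measurable (Filt E n)"
    by (rule horizon_measurable_compose[OF value_lim_measurable _ Xn_Filt_measurable[OF E_borel k]]) measurable
  show ?thesis unfolding stop_now_def by measurable
qed

lemma is_stopping_time_first_stop: "is_stopping_time E (first_stop s)"
  unfolding is_stopping_time_def
proof
  fix n
  have "Measurable.pred (Filt E n) (\<lambda>\<omega>. stop_now s \<omega> n \<and> (\<forall>k\<in>{..<n}. \<not> stop_now s \<omega> k))"
    by (intro pred_intros_logic pred_intros_finite stop_now_measurable) auto
  then show "{\<omega> \<in> space (Omega E). first_stop s \<omega> = enat n} \<in> sets (Filt E n)"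
    by (simp add: first_stop_def enat_Least_eq_enat pred_def space_Filt Ball_def)
qed

text \<open>Until \<open>first_stop\<close> the fixed point equation is attained by continuing, and
  at \<open>first_stop\<close> either the value equals the terminal cost or the horizon is exhausted
  and no terminal cost is due. So no step loses anything against \<open>value_lim\<close>.\<close>

lemma Vtau_first_stop_le:
  assumes x: "x \<in> E"
  shows "Vtau P c g (first_stop s) s x \<le> value_lim s x"
proof -
  note \<tau> = is_stopping_time_first_stop[of s]
  define w where "w k = (\<integral>\<^sup>+\<omega>. (if enat k \<le> first_stop s \<omega> then value_lim (s - Sn \<omega> k) (Xn \<omega> k) else 0) \<partial>P x)" for k
  define a where "a k = (\<integral>\<^sup>+\<omega>. stop_cost g s (first_stop s) k \<omega> + step_cost c s (first_stop s) k \<omega> \<partial>P x)" for k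
  have step: "a k + w (Suc k) \<le> w k" for k
  proof -
    have "a k + w (Suc k) = (\<integral>\<^sup>+\<omega>. stop_cost g s (first_stop s) k \<omega>
        + (if enat k < first_stop s \<omega> then step_op value_lim (s - Sn \<omega> k) (Xn \<omega> k) else 0) \<partial>P x)"
      unfolding a_def w_def by (rule one_step[OF x \<tau> value_lim_measurable])
    also have "\<dots> \<le> w k"
      unfolding w_def
    proof (rule nn_integral_mono)
      fix \<omega> assume "\<omega> \<in> space (P x)"
      then have X: "Xn \<omega> k \<in> E" by (simp add: Xn_in_E[OF E_borel] space_P x)
      consider "first_stop s \<omega> = enat k" | "enat k < first_stop s \<omega>" | "first_stop s \<omega> < enat k" by fastforce
      then show "stop_cost g s (first_stop s) k \<omega> + (if enat k < first_stop s \<omega> then step_op value_lim (s - Sn \<omega> k) (Xn \<omega> k) else 0)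
          \<le> (if enat k \<le> first_stop s \<omega> then value_lim (s - Sn \<omega> k) (Xn \<omega> k) else 0)"
      proof cases
        case 1
        then have "stop_now s \<omega> k" by (simp add: first_stop_def enat_Least_eq_enat)
        then show ?thesis using 1 by (auto simp: stop_cost_def stop_now_def)
      next
        case 2
        have "\<not> stop_now s \<omega> k"
        proof
          assume "stop_now s \<omega> k"
          then have "first_stop s \<omega> \<le> enat k" by (auto simp: first_stop_def enat_Least_def intro: Least_le)
          with 2 show False by simp
        qed
        \<comment> \<open>Not stopping means a positive remaining horizon and a value different from
          \<open>g\<close>, so the minimum is the other argument.\<close>
        then have "value_lim (s - Sn \<omega> k) (Xn \<omega> k) = step_op value_lim (s - Sn \<omega> k) (Xn \<omega> k)"
          using value_lim_fixpoint[OF X, of "s - Sn \<omega> k"] by (auto simp: stop_now_def min_def split: if_splits)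
        then show ?thesis using 2 by (auto simp: stop_cost_def)
      next
        case 3
        then show ?thesis by (auto simp: stop_cost_def)
      qed
    qed
    finally show ?thesis .
  qed
  have "sum a {..<n} + w n \<le> w 0" for n
  proof (induction n)
    case (Suc n)
    have "sum a {..<Suc n} + w (Suc n) = sum a {..<n} + (a n + w (Suc n))" by (simp add: add.assoc)
    also have "\<dots> \<le> sum a {..<n} + w n" by (intro add_left_mono step)
    also have "\<dots> \<le> w 0" by (rule Suc)
    finally show ?case .
  qed simp
  \<comment> \<open>The remainder \<open>w n\<close> is nonnegative and can be discarded, so its
    limit is irrelevant.\<close>
  then have "sum a {..<n} \<le> w 0" for n
    by (rule order_trans[OF add_increasing2[OF zero_le order_refl]])
  then have "suminf a \<le> w 0" by (intro suminf_le_const summableI)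
  also have "w 0 = value_lim s x"
    unfolding w_def by (rule value_at_0[OF x value_lim_measurable])
  finally show ?thesis
    by (simp add: a_def[abs_def] Vtau_eq_suminf[OF x \<tau>])
qed

section \<open>Identification of the value function and transfer to \<open>tau_star\<close>\<close>

lemma Vstar_eq_value_lim: "x \<in> E \<Longrightarrow> Vstar E P c g s x = value_lim s x"
  unfolding Vstar_def
  by (intro antisym INF_lower2[of "first_stop s"] INF_greatest) (auto simp: is_stopping_time_first_stop Vtau_first_stop_le value_lim_le_Vtau)

text \<open>On the path space \<open>Sn\<close> is nonnegative, so the remaining horizon never
  exceeds s, and a remaining horizon outside the range of \<open>Dstar\<close> is one covered by
  \<open>s \<le> Sn \<omega> n\<close>.\<close>

lemma tau_star_eq_first_stop:
  assumes "\<omega> \<in> space (Omega E)"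
  shows "tau_star E P c g s \<omega> = first_stop s \<omega>"
proof -
  have "0 \<le> Sn \<omega> n" for n
    unfolding Sn_def using Tn_nonneg[OF E_borel assms] by (intro sum_nonneg) auto
  then have "(s - Sn \<omega> n, Xn \<omega> n) \<in> Dstar E P c g s \<or> s \<le> Sn \<omega> n \<longleftrightarrow> stop_now s \<omega> n" for n
    using Xn_in_E[OF E_borel assms, of n] by (auto simp: Dstar_def stop_now_def Vstar_eq_value_lim)
  then show ?thesis by (simp add: tau_star_def first_stop_def enat_Least_min)
qed

lemma tau_star_stopping_time: "is_stopping_time E (tau_star E P c g s)"
  using is_stopping_time_first_stop[of s] unfolding is_stopping_time_def
  by (simp add: tau_star_eq_first_stop cong: conj_cong)

lemma tau_star_optimal:
  assumes x: "x \<in> E"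
  shows "Vtau P c g (tau_star E P c g s) s x = Vstar E P c g s x"
proof -
  have "Vtau P c g (tau_star E P c g s) s x = Vtau P c g (first_stop s) s x"
    unfolding Vtau_def
    by (rule nn_integral_cong) (simp add: Reward_def Stau_def tau_star_eq_first_stop space_P[OF x])
  also have "\<dots> = value_lim s x"
    using Vtau_first_stop_le[OF x] value_lim_le_Vtau[OF x is_stopping_time_first_stop] by (rule antisym)
  finally show ?thesis by (simp add: Vstar_eq_value_lim[OF x])
qed

lemma tau_star_finite:
  assumes x: "x \<in> E"
  shows "measure (P x) {\<omega>\<in>space (P x). tau_star E P c g s \<omega> = \<infinity>} = 0"
proof -
  have "AE \<omega> in P x. tau_star E P c g s \<omega> \<noteq> \<infinity>"
    using AE_no_explosion[OF x]
  proof eventually_elim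
    case (elim \<omega>)
    then obtain n where "s \<le> Sn \<omega> n"
      by (auto simp: filterlim_at_top eventually_sequentially)
    then have "enat_Least (\<lambda>n. s \<le> Sn \<omega> n) \<noteq> \<infinity>" by (auto simp: enat_Least_def)
    then show ?case by (auto simp: tau_star_def min_def dest: enat_ile)
  qed
  \<comment> \<open>A measurable null cover bounds the measure of the event without a separate proof
    that the event is measurable.\<close>
  then obtain N where "{\<omega>\<in>space (P x). \<not> tau_star E P c g s \<omega> \<noteq> \<infinity>} \<subseteq> N" "N \<in> sets (P x)" "emeasure (P x) N = 0"
    by (rule AE_E)
  then have "emeasure (P x) {\<omega>\<in>space (P x). tau_star E P c g s \<omega> = \<infinity>} \<le> 0"
    using emeasure_mono[of _ N "P x"] by simp
  then show ?thesis by (simp add: measure_def)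
qed

end

theorem theorem4p4:
  fixes E :: "'a::polish_space set"
    and Q :: "real \<Rightarrow> 'a set \<Rightarrow> 'a \<Rightarrow> real"
    and P :: "'a \<Rightarrow> 'a path measure"
    and c g :: "'a \<Rightarrow> real"
    and T :: real
  assumes E_borel: "E \<in> sets borel" and E_ne: "E \<noteq> {}"
    and Q_kernel: "semi_Markov_kernel E Q"
    and regular: "\<exists>\<delta>>0. \<exists>\<epsilon>>0. \<forall>x\<in>E. Q \<delta> E x \<le> 1 - \<epsilon>"
    and c_meas: "c \<in> borel_measurable (ME E)" and c_nonneg: "\<forall>x\<in>E. 0 \<le> c x"
    and g_meas: "g \<in> borel_measurable (ME E)" and g_nonneg: "\<forall>x\<in>E. 0 \<le> g x"
    and T_nonneg: "0 \<le> T"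
    and P_law: "\<forall>x\<in>E. semi_Markov_law E Q x (P x)"
  shows "is_stopping_time E (tau_star E P c g T)
         \<and> (\<forall>x\<in>E. Vtau P c g (tau_star E P c g T) T x = Vstar E P c g T x)
         \<and> (\<forall>x\<in>E. measure (P x) {\<omega>\<in>space (P x). tau_star E P c g T \<omega> = \<infinity>} = 0)"
proof -
  interpret semi_Markov_stopping E Q P c g
    by standard fact+
  show ?thesis
    using tau_star_stopping_time tau_star_optimal tau_star_finite by blast
qed

end
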